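(* Let $\mu_1\le\mu_2\le\mu_3<0$ and let $u=(u_1,u_2,u_3)\in H^1(\mathbb{R})^3$ be any solution of $$u_i''+2(u_1^2+u_2^2+u_3^2)u_i=-\mu_iu_i\quad\text{in }\mathbb{R},\qquad i=1,2,3,$$ satisfying $u_i\not\equiv0$ for all $i=1,2,3$. Then the linearized system at $u$, $$\phi_i''+2(u_1^2+u_2^2+u_3^2)\phi_i+4(u_1\phi_1+u_2\phi_2+u_3\phi_3)u_i=-\mu_i\phi_i\quad\text{in }\mathbb{R},\qquad i=1,2,3,$$ is non-degenerate, in the sense that the dimension of the space of solutions $(\phi_1,\phi_2,\phi_3)\in H^1(\mathbb{R})^3$ of this linearized system is three.
   Context: All functions are real-valued, and the dimension is over $\mathbb{R}$. *)

theory Defs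
  imports "HOL-Analysis.Analysis"
begin

section \<open>Weak derivatives and the Sobolev space on the line\<close>

text \<open>Sobolev functions are represented by ordinary functions; every notion below is invariant
  under changing a function on a Lebesgue null set.\<close>

definition test_function :: "(real \<Rightarrow> real) \<Rightarrow> bool" where
  "test_function \<eta> \<longleftrightarrow>
     (\<forall>k. (deriv ^^ k) \<eta> differentiable_on UNIV) \<and> compact (closure {x. \<eta> x \<noteq> 0})"

definition locally_integrable :: "(real \<Rightarrow> real) \<Rightarrow> bool" where
  "locally_integrable f \<longleftrightarrow> (\<forall>K. compact K \<longrightarrow> set_integrable lebesgue K f)"

definition has_weak_deriv :: "nat \<Rightarrow> (real \<Rightarrow> real) \<Rightarrow> (real \<Rightarrow> real) \<Rightarrow> bool" where
  "has_weak_deriv k f g \<longleftrightarrow> locally_integrable f \<and> locally_integrable g \<and>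
     (\<forall>\<eta>. test_function \<eta> \<longrightarrow>
        (LINT x|lebesgue. f x * (deriv ^^ k) \<eta> x) = (-1) ^ k * (LINT x|lebesgue. g x * \<eta> x))"

definition L2 :: "(real \<Rightarrow> real) set" where
  "L2 = {f \<in> borel_measurable lebesgue. integrable lebesgue (\<lambda>x. (f x)\<^sup>2)}"

definition H1 :: "(real \<Rightarrow> real) set" where
  "H1 = {f \<in> L2. \<exists>g \<in> L2. has_weak_deriv 1 f g}"

section \<open>The nonlinear system and its linearization\<close>

text \<open>The second derivatives are weak derivatives; since the other terms are locally integrable
  for functions in \<open>H1\<close>, this is the same as requiring the equations to hold as distributions.\<close>

definition is_solution :: "real ^ 3 \<Rightarrow> (real \<Rightarrow> real ^ 3) \<Rightarrow> bool" where
  "is_solution \<mu> u \<longleftrightarrow> (\<forall>i. (\<lambda>x. u x $ i) \<in> H1) \<and>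
     (\<forall>i. \<exists>u''. has_weak_deriv 2 (\<lambda>x. u x $ i) u'' \<and>
        (AE x in lebesgue.
           u'' x + 2 * ((u x $ 1)\<^sup>2 + (u x $ 2)\<^sup>2 + (u x $ 3)\<^sup>2) * u x $ i = - (\<mu> $ i) * u x $ i))"

definition is_linearized_solution ::
  "real ^ 3 \<Rightarrow> (real \<Rightarrow> real ^ 3) \<Rightarrow> (real \<Rightarrow> real ^ 3) \<Rightarrow> bool" where
  "is_linearized_solution \<mu> u \<phi> \<longleftrightarrow> (\<forall>i. (\<lambda>x. \<phi> x $ i) \<in> H1) \<and>
     (\<forall>i. \<exists>\<phi>''. has_weak_deriv 2 (\<lambda>x. \<phi> x $ i) \<phi>'' \<and>
        (AE x in lebesgue.
           \<phi>'' x + 2 * ((u x $ 1)\<^sup>2 + (u x $ 2)\<^sup>2 + (u x $ 3)\<^sup>2) * \<phi> x $ i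
             + 4 * (u x $ 1 * \<phi> x $ 1 + u x $ 2 * \<phi> x $ 2 + u x $ 3 * \<phi> x $ 3) * u x $ i
           = - (\<mu> $ i) * \<phi> x $ i))"

section \<open>Functions modulo equality almost everywhere\<close>

text \<open>The vector space in which dimensions of spaces of Sobolev functions are taken. No
  measurability is built into the type.\<close>

quotient_type (overloaded) 'a ae_fun = "real \<Rightarrow> 'a::real_vector" /
  "\<lambda>f g. AE x in lebesgue. f x = g x"
  morphisms rep_ae_fun ae_class
proof (rule equivpI)
  show "reflp (\<lambda>f g :: real \<Rightarrow> 'a. AE x in lebesgue. f x = g x)"
    by (simp add: reflp_def)
  show "symp (\<lambda>f g :: real \<Rightarrow> 'a. AE x in lebesgue. f x = g x)"
    by (rule sympI) (auto elim: eventually_mono)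
  show "transp (\<lambda>f g :: real \<Rightarrow> 'a. AE x in lebesgue. f x = g x)"
  proof (rule transpI)
    fix f g h :: "real \<Rightarrow> 'a"
    assume "AE x in lebesgue. f x = g x" "AE x in lebesgue. g x = h x"
    then show "AE x in lebesgue. f x = h x"
      by eventually_elim simp
  qed
qed

instantiation ae_fun :: (real_vector) real_vector
begin

lift_definition zero_ae_fun :: "'a ae_fun" is "\<lambda>_. 0" .

lift_definition plus_ae_fun :: "'a ae_fun \<Rightarrow> 'a ae_fun \<Rightarrow> 'a ae_fun" is "\<lambda>f g x. f x + g x"
  by (rule eventually_elim2) auto

lift_definition minus_ae_fun :: "'a ae_fun \<Rightarrow> 'a ae_fun \<Rightarrow> 'a ae_fun" is "\<lambda>f g x. f x - g x"
  by (rule eventually_elim2) auto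

lift_definition uminus_ae_fun :: "'a ae_fun \<Rightarrow> 'a ae_fun" is "\<lambda>f x. - f x"
  by (auto elim: eventually_mono)

lift_definition scaleR_ae_fun :: "real \<Rightarrow> 'a ae_fun \<Rightarrow> 'a ae_fun" is "\<lambda>c f x. c *\<^sub>R f x"
  by (auto elim: eventually_mono)

instance
  by standard (transfer; simp add: algebra_simps)+

end

definition linearized_solution_space ::
  "real ^ 3 \<Rightarrow> (real \<Rightarrow> real ^ 3) \<Rightarrow> (real ^ 3) ae_fun set" where
  "linearized_solution_space \<mu> u = ae_class ` {\<phi>. is_linearized_solution \<mu> u \<phi>}"

end

theory Submission
  imports Defs
begin

text \<open>
  Put \<open>\<kappa>\<^sub>i = - \<mu>\<^sub>i > 0\<close>. After replacing \<open>u\<close> by its classical representative, the system reads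
  \<open>u\<^sub>l'' = \<kappa>\<^sub>l u\<^sub>l - 2 \<bar>u\<bar>\<^sup>2 u\<^sub>l\<close>. Let \<open>S\<^sub>l\<^sub>j(x)\<close> be the integral of \<open>u\<^sub>l u\<^sub>j\<close> over \<open>[x, \<infinity>)\<close>.
  The whole proof rests on an explicit formula: for every constant vector \<open>c\<close>,
  \<open>\<phi>\<^sup>c\<^sub>l = c\<^sub>l u\<^sub>l' - (\<Sum>j. (c\<^sub>l - c\<^sub>j) S\<^sub>l\<^sub>j u\<^sub>j)\<close>
  is an \<open>H\<^sup>1\<close> solution of the linearized system. When the \<open>\<kappa>\<^sub>i\<close> are distinct, the Wronskian relation
  \<open>u\<^sub>l u\<^sub>j' - u\<^sub>l' u\<^sub>j = (\<kappa>\<^sub>l - \<kappa>\<^sub>j) S\<^sub>l\<^sub>j\<close> turns \<open>\<phi>\<^sup>c\<close> into the velocity of the commuting flows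
  generated by those first integrals of this completely integrable (Garnier) system that are
  quadratic in the velocities;
  \<open>c = (1, \<dots>, 1)\<close> gives translation. Those first integrals have the denominators
  \<open>\<kappa>\<^sub>l - \<kappa>\<^sub>j\<close>, which the overlaps \<open>S\<^sub>l\<^sub>j\<close> absorb, so coinciding \<open>\<kappa>\<^sub>i\<close> need no separate treatment.
  That \<open>\<phi>\<^sup>c\<close> solves the linearized system is then an algebraic consequence of the equation,
  of \<open>S\<^sub>l\<^sub>j' = - u\<^sub>l u\<^sub>j\<close> and of the Wronskian relation (\<open>variation_deriv_has_deriv\<close>).

  The map \<open>c \<mapsto> \<phi>\<^sup>c\<close> is injective even when evaluated at a single point \<open>x0\<close> far to the right
  (\<open>exists_variation_injective\<close>): there \<open>\<bar>u\<^sub>l'\<bar> \<ge> \<delta> \<bar>u\<^sub>l\<bar>\<close> while \<open>\<bar>S\<^sub>l\<^sub>j\<bar> \<le> \<bar>u\<^sub>l u\<^sub>j\<bar> / (2 \<delta>)\<close>, so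
  the term \<open>c\<^sub>l u\<^sub>l'\<close> with the largest \<open>\<bar>c\<^sub>l\<bar>\<close> dominates the sum. Hence every vector is some
  \<open>\<phi>\<^sup>c(x0)\<close>.

  There are no other \<open>H\<^sup>1\<close> solutions (\<open>linearized_imp_variation\<close>). The linearized system is
  symmetric, so the symplectic form \<open>\<Sum>l. \<phi>\<^sub>l \<psi>\<^sub>l' - \<phi>\<^sub>l' \<psi>\<^sub>l\<close> of two solutions is constant, and it
  is \<open>0\<close> if both decay. Given a solution \<open>\<phi>\<close>, subtract the \<open>\<phi>\<^sup>c\<close> that agrees with it at \<open>x0\<close>. The
  difference \<open>\<theta>\<close> vanishes at \<open>x0\<close>, so its form with \<open>\<phi>\<^sup>d\<close> is \<open>- \<theta>'(x0) \<bullet> \<phi>\<^sup>d(x0)\<close>; as this is zero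
  for all \<open>d\<close>, also \<open>\<theta>'(x0) = 0\<close>, and \<open>\<theta>\<close> vanishes by uniqueness for the initial value problem.

  What remains is the passage between weak and classical solutions: a function in \<open>H\<^sup>1\<close> whose second
  weak derivative is locally integrable has a continuously differentiable representative
  (\<open>H1_weak_deriv_2_imp_C1\<close>), and the equation then makes it twice differentiable. This comes from
  the fundamental lemma of the calculus of variations and the du Bois-Reymond lemma.
\<close>

section \<open>Smooth functions and cut-offs\<close>

lemma continuous_on_if_deriv:
  assumes "\<And>x. (F has_real_derivative G x) (at x)"
  shows "continuous_on A F"
  using assms by (meson DERIV_continuous_on DERIV_subset subset_UNIV)

definition smooth :: "(real \<Rightarrow> real) \<Rightarrow> bool" where
  "smooth f \<longleftrightarrow> (\<forall>k. (deriv ^^ k) f differentiable_on UNIV)"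

lemma smooth_has_deriv:
  assumes "smooth f"
  shows "(f has_real_derivative deriv f x) (at x)"
proof -
  have "f differentiable_on UNIV"
    using assms unfolding smooth_def by (metis funpow_0)
  then have "f differentiable (at x)"
    by (simp add: differentiable_on_def)
  then show ?thesis
    using DERIV_deriv_iff_real_differentiable by blast
qed

lemma smooth_deriv: "smooth f \<Longrightarrow> smooth (deriv f)"
  unfolding smooth_def by (metis funpow_simps_right(2) o_apply)

text \<open>Any class of functions that is closed under differentiation consists of smooth functions; this
  replaces computing the derivatives of each order.\<close>

lemma smooth_coinduct:
  assumes "P f"
    and step: "\<And>g. P g \<Longrightarrow> \<exists>g'. P g' \<and> (\<forall>x. (g has_real_derivative g' x) (at x))"
  shows "smooth f"
proof -
  have closed: "(\<forall>x. (g has_real_derivative deriv g x) (at x)) \<and> P (deriv g)" if Pg: "P g" for g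
  proof -
    obtain g' where g': "P g'" "\<forall>x. (g has_real_derivative g' x) (at x)"
      using step[OF Pg] by blast
    then have "deriv g = g'"
      by (auto intro: DERIV_imp_deriv)
    with g' show ?thesis
      by simp
  qed
  have "P ((deriv ^^ k) f)" for k
    by (induction k) (use assms(1) closed in auto)
  then show ?thesis
    unfolding smooth_def using closed
    by (meson DERIV_deriv_iff_real_differentiable differentiable_on_def differentiable_at_withinI)
qed

lemma smooth_const: "smooth (\<lambda>x. c)"
  by (rule smooth_coinduct[of "\<lambda>g. \<exists>c. g = (\<lambda>x. c)"]) (auto intro!: exI[of _ "\<lambda>x. 0"])

text \<open>The algebra generated by the smooth functions: the product rule leads out of the set of products
  but not out of this class, which makes \<open>smooth_coinduct\<close> applicable to products.\<close>

inductive smooth_expression :: "(real \<Rightarrow> real) \<Rightarrow> bool" where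
  base: "smooth f \<Longrightarrow> smooth_expression f"
| add: "smooth_expression f \<Longrightarrow> smooth_expression g \<Longrightarrow> smooth_expression (\<lambda>x. f x + g x)"
| mult: "smooth_expression f \<Longrightarrow> smooth_expression g \<Longrightarrow> smooth_expression (\<lambda>x. f x * g x)"

lemma smooth_expression_imp_smooth: "smooth_expression f \<Longrightarrow> smooth f"
proof (erule smooth_coinduct)
  fix g assume "smooth_expression g"
  then show "\<exists>g'. smooth_expression g' \<and> (\<forall>x. (g has_real_derivative g' x) (at x))"
  proof induction
    case (base f)
    then show ?case
      by (meson smooth_deriv smooth_has_deriv smooth_expression.base)
  next
    case (add f g)
    then obtain f' g' where "smooth_expression f'" "\<forall>x. (f has_real_derivative f' x) (at x)"
      "smooth_expression g'" "\<forall>x. (g has_real_derivative g' x) (at x)"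
      by blast
    then show ?case
      by (intro exI[of _ "\<lambda>x. f' x + g' x"] conjI)
        (auto intro!: smooth_expression.add derivative_eq_intros)
  next
    case (mult f g)
    then obtain f' g' where "smooth_expression f'" "\<forall>x. (f has_real_derivative f' x) (at x)"
      "smooth_expression g'" "\<forall>x. (g has_real_derivative g' x) (at x)"
      by blast
    with mult.hyps show ?case
      by (intro exI[of _ "\<lambda>x. f' x * g x + g' x * f x"] conjI)
        (auto intro!: smooth_expression.add smooth_expression.mult DERIV_mult)
  qed
qed

lemma smooth_add: "smooth f \<Longrightarrow> smooth g \<Longrightarrow> smooth (\<lambda>x. f x + g x)"
  and smooth_mult: "smooth f \<Longrightarrow> smooth g \<Longrightarrow> smooth (\<lambda>x. f x * g x)"
  by (blast intro: smooth_expression_imp_smooth smooth_expression.intros)+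

lemma smooth_cmult: "smooth f \<Longrightarrow> smooth (\<lambda>x. c * f x)"
  by (intro smooth_mult smooth_const)

lemma smooth_diff: "smooth f \<Longrightarrow> smooth g \<Longrightarrow> smooth (\<lambda>x. f x - g x)"
  using smooth_add[of f "\<lambda>x. (-1) * g x"] smooth_cmult[of g "-1"] by simp

lemma smooth_power: "smooth f \<Longrightarrow> smooth (\<lambda>x. f x ^ n)"
  by (induction n) (auto intro: smooth_const smooth_mult)

lemma smooth_affine:
  assumes "smooth f"
  shows "smooth (\<lambda>x. f (m * x + c))"
proof (rule smooth_coinduct[of "\<lambda>g. \<exists>d f. smooth f \<and> g = (\<lambda>x. d * f (m * x + c))"])
  show "\<exists>d h. smooth h \<and> (\<lambda>x. f (m * x + c)) = (\<lambda>x. d * h (m * x + c))"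
    using assms by (intro exI[of _ 1] exI[of _ f]) auto
next
  fix g assume "\<exists>d f. smooth f \<and> g = (\<lambda>x. d * f (m * x + c))"
  then obtain d f where f: "smooth f" and g: "g = (\<lambda>x. d * f (m * x + c))"
    by blast
  have "(g has_real_derivative (d * m) * deriv f (m * x + c)) (at x)" for x
    unfolding g
    by (auto intro!: derivative_eq_intros DERIV_chain2[OF smooth_has_deriv[OF f]])
  then show "\<exists>g'. (\<exists>d f. smooth f \<and> g' = (\<lambda>x. d * f (m * x + c))) \<and>
      (\<forall>x. (g has_real_derivative g' x) (at x))"
    using smooth_deriv[OF f] by (intro exI[of _ "\<lambda>x. (d * m) * deriv f (m * x + c)"]) blast
qed

text \<open>For \<open>p = 1\<close> this is the standard smooth function all of whose derivatives vanish at the origin. The polynomial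
  factor makes the family closed under differentiation.\<close>

definition flat :: "real poly \<Rightarrow> real \<Rightarrow> real" where
  "flat p x = (if x > 0 then poly p (1 / x) * exp (- (1 / x)) else 0)"

lemma poly_times_exp_tendsto_0: "((\<lambda>y. poly p y * exp (- y)) \<longlongrightarrow> 0) (at_top :: real filter)"
proof -
  have "((\<lambda>y. \<Sum>i\<le>degree p. coeff p i * (y ^ i / exp y)) \<longlongrightarrow> (\<Sum>i\<le>degree p. coeff p i * 0)) 
      (at_top :: real filter)"
    by (intro tendsto_intros tendsto_power_div_exp_0)
  then show ?thesis
    by (simp add: poly_altdef sum_distrib_right exp_minus divide_inverse mult.assoc)
qed

lemma flat_has_deriv:
  "(flat p has_real_derivative flat ((p - pderiv p) * [:0, 0, 1:]) x) (at x)"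
proof (cases x "0 :: real" rule: linorder_cases)
  case less
  then have "eventually (\<lambda>y. flat p y = 0) (nhds x)"
    by (auto simp: flat_def intro!: eventually_mono[OF eventually_nhds_in_open[of "{..<0}"]])
  moreover have "((\<lambda>y. 0) has_real_derivative 0) (at x)"
    by simp
  ultimately show ?thesis
    using less by (subst DERIV_cong_ev[OF refl _ refl]) (auto simp: flat_def)
next
  case greater
  have "eventually (\<lambda>y. flat p y = poly p (1 / y) * exp (- (1 / y))) (nhds x)"
    using greater
    by (auto simp: flat_def intro!: eventually_mono[OF eventually_nhds_in_open[of "{0<..}"]])
  moreover have "((\<lambda>y. poly p (1 / y) * exp (- (1 / y))) has_real_derivative 
      (poly p (1 / x) - poly (pderiv p) (1 / x)) * (1 / x)\<^sup>2 * exp (- (1 / x))) (at x)"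
    using greater
    by (auto intro!: derivative_eq_intros DERIV_chain2[OF poly_DERIV]
        simp: power2_eq_square field_simps)
  ultimately show ?thesis
    using greater
    by (subst DERIV_cong_ev[OF refl _ refl]) (auto simp: flat_def power2_eq_square)
next
  case equal
  have "((\<lambda>h. flat p h / h) \<longlongrightarrow> 0) (at_right 0)"
  proof -
    have "((\<lambda>h. poly ([:0, 1:] * p) (inverse h) * exp (- inverse h)) \<longlongrightarrow> 0) (at_right (0 :: real))"
      by (rule filterlim_compose[OF poly_times_exp_tendsto_0 filterlim_inverse_at_top_right])
    then show ?thesis
      by (rule Lim_transform_eventually)
        (auto simp: flat_def eventually_at_right_less field_simps
          intro!: eventually_mono[OF eventually_at_right_less])
  qed
  moreover have "((\<lambda>h. flat p h / h) \<longlongrightarrow> 0) (at_left 0)"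
    by (rule tendsto_eventually, rule eventually_mono[OF eventually_at_left_real[of "-1" 0]])
      (auto simp: flat_def)
  ultimately have "((\<lambda>h. flat p h / h) \<longlongrightarrow> 0) (at 0)"
    by (simp add: filterlim_split_at)
  then show ?thesis
    using equal by (simp add: has_field_derivative_iff flat_def)
qed

lemma smooth_flat: "smooth (flat p)"
  by (rule smooth_coinduct[of "\<lambda>g. \<exists>p. g = flat p"]) (use flat_has_deriv in blast)+

lemma test_functionI:
  assumes "smooth \<eta>" and "\<And>x. x \<notin> {a..b} \<Longrightarrow> \<eta> x = 0"
  shows "test_function \<eta>"
proof -
  have "{x. \<eta> x \<noteq> 0} \<subseteq> {a..b}"
    using assms(2) by blast
  then have "bounded {x. \<eta> x \<noteq> 0}"
    using bounded_closed_interval bounded_subset by blast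
  then show ?thesis
    using assms(1) by (simp add: test_function_def smooth_def)
qed

lemma test_function_smooth: "test_function \<eta> \<Longrightarrow> smooth \<eta>"
  by (simp add: test_function_def smooth_def)

lemma test_function_support:
  assumes "test_function \<eta>"
  obtains R where "R > 0" "\<And>x. \<bar>x\<bar> \<ge> R \<Longrightarrow> \<eta> x = 0"
proof -
  have "bounded (closure {x. \<eta> x \<noteq> 0})"
    using assms by (intro compact_imp_bounded) (simp add: test_function_def)
  then have "bounded {x. \<eta> x \<noteq> 0}"
    using bounded_subset closure_subset by blast
  then obtain R where R: "R > 0" "\<And>x. \<eta> x \<noteq> 0 \<Longrightarrow> \<bar>x\<bar> \<le> R"
    unfolding bounded_pos by auto
  show thesis
  proof (rule that[of "R + 1"])
    show "\<eta> x = 0" if "\<bar>x\<bar> \<ge> R + 1" for x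
      using R(2)[of x] that by fastforce
  qed (use R in simp)
qed

lemma test_function_deriv:
  assumes "test_function \<eta>"
  shows "test_function (deriv \<eta>)"
proof -
  obtain R where R: "R > 0" "\<And>x. \<bar>x\<bar> \<ge> R \<Longrightarrow> \<eta> x = 0"
    using test_function_support[OF assms] by blast
  have "deriv \<eta> x = 0" if "x \<notin> {-R..R}" for x
  proof -
    have "eventually (\<lambda>y. \<eta> y = 0) (nhds x)"
    proof (rule eventually_mono[OF eventually_nhds_in_open[of "- {-R..R}"]])
      show "\<And>y. y \<in> - {- R..R} \<Longrightarrow> \<eta> y = 0"
        by (rule R(2)) auto
    qed (use that in auto)
    then have "(\<eta> has_real_derivative 0) (at x)"
      by (subst DERIV_cong_ev[OF refl _ refl]) auto
    then show ?thesis
      by (rule DERIV_imp_deriv)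
  qed
  then show ?thesis
    by (rule test_functionI[OF smooth_deriv[OF test_function_smooth[OF assms]]])
qed

lemma test_function_continuous: "test_function \<eta> \<Longrightarrow> continuous_on A \<eta>"
  by (rule continuous_on_if_deriv[OF smooth_has_deriv[OF test_function_smooth]])

definition bump :: "real \<Rightarrow> real \<Rightarrow> real \<Rightarrow> real" where
  "bump a b x = flat 1 (x - a) * flat 1 (b - x)"

lemma bump_range: "0 \<le> bump a b x" "bump a b x < 1"
  and bump_pos_iff: "0 < bump a b x \<longleftrightarrow> a < x \<and> x < b"
proof -
  have flat: "0 \<le> flat 1 y" "flat 1 y < 1" "0 < flat 1 y \<longleftrightarrow> 0 < y" for y
    by (auto simp: flat_def)
  show "0 \<le> bump a b x" 
    by (simp add: bump_def flat)
  have "flat 1 (x - a) * flat 1 (b - x) \<le> 1 * flat 1 (b - x)"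
    using flat by (intro mult_right_mono) (auto simp: less_imp_le)
  then show "bump a b x < 1"
    using flat(2)[of "b - x"] by (simp add: bump_def)
  show "0 < bump a b x \<longleftrightarrow> a < x \<and> x < b"
    using flat by (auto simp: bump_def zero_less_mult_iff not_less[symmetric])
qed

lemma smooth_bump: "smooth (bump a b)"
proof -
  have "smooth (\<lambda>x. flat 1 (1 * x + (- a)) * flat 1 ((-1) * x + b))"
    by (intro smooth_mult smooth_affine smooth_flat)
  then show ?thesis
    by (simp add: bump_def[abs_def] algebra_simps)
qed

text \<open>As \<open>n \<rightarrow> \<infinity>\<close> these functions increase to the indicator of the open interval from \<open>a\<close> to \<open>b\<close>,
  because \<open>bump\<close> is positive exactly there and stays below \<open>1\<close>. They provide approximate
  indicators without mollification.\<close>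

lemma test_function_plateau: "test_function (\<lambda>x. 1 - (1 - bump a b x) ^ n)"
proof (rule test_functionI)
  show "smooth (\<lambda>x. 1 - (1 - bump a b x) ^ n)"
    by (intro smooth_diff smooth_power smooth_const smooth_bump)
  show "1 - (1 - bump a b x) ^ n = 0" if "x \<notin> {a..b}" for x
    using that bump_pos_iff[of a b x] bump_range(1)[of a b x] by auto
qed

section \<open>The fundamental lemma of the calculus of variations\<close>

lemma integrable_lebesgue_bounded_mult:
  fixes f g :: "real \<Rightarrow> real"
  assumes f: "integrable lebesgue f" and g: "g \<in> borel_measurable lebesgue"
    and bound: "\<And>x. \<bar>g x\<bar> \<le> C"
  shows "integrable lebesgue (\<lambda>x. f x * g x)"
proof (rule Bochner_Integration.integrable_bound)
  show "integrable lebesgue (\<lambda>x. C * \<bar>f x\<bar>)"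
    using f by simp
  show "(\<lambda>x. f x * g x) \<in> borel_measurable lebesgue"
    using f g by (intro borel_measurable_times) auto
  have "\<bar>f x\<bar> * \<bar>g x\<bar> \<le> C * \<bar>f x\<bar>" for x
    using mult_left_mono[OF bound[of x], of "\<bar>f x\<bar>"] by (simp add: mult.commute)
  then show "AE x in lebesgue. norm (f x * g x) \<le> norm (C * \<bar>f x\<bar>)"
    by (intro AE_I2) (metis abs_ge_self abs_mult order_trans real_norm_def)
qed

lemma continuous_measurable_lebesgue:
  fixes f :: "real \<Rightarrow> real"
  assumes "continuous_on UNIV f"
  shows "f \<in> borel_measurable lebesgue"
  using assms by (simp add: borel_measurable_continuous_onI measurable_completion)

lemma locally_integrable_interval:
  assumes "locally_integrable h"
  shows "integrable lebesgue (\<lambda>x. indicator {a..b} x * h x)"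
  using assms compact_Icc[of a b] by (auto simp: locally_integrable_def set_integrable_def)

lemma locally_integrableI:
  assumes "\<And>R. integrable lebesgue (\<lambda>x. indicator {-R..R::real} x * h x)"
  shows "locally_integrable h"
  unfolding locally_integrable_def
proof (intro allI impI)
  fix K :: "real set" assume K: "compact K"
  then obtain R where "K \<subseteq> {-R..R}"
    by (metis atLeastAtMost_iff bounded_iff compact_imp_bounded real_norm_def abs_le_iff
        minus_le_iff subsetI)
  moreover have "set_integrable lebesgue {-R..R} h"
    using assms[of R] by (simp add: set_integrable_def)
  moreover have "K \<in> sets lebesgue"
    using K by (simp add: borel_compact)
  ultimately show "set_integrable lebesgue K h"
    using set_integrable_subset by blast
qed

lemma locally_integrable_continuous:
  fixes f :: "real \<Rightarrow> real"
  assumes "continuous_on UNIV f"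
  shows "locally_integrable f"
proof (rule locally_integrableI)
  fix R :: real
  have "integrable lborel (\<lambda>x. indicator {-R..R} x *\<^sub>R f x)"
    by (rule borel_integrable_compact) (use assms continuous_on_subset in auto)
  then have "integrable lebesgue (\<lambda>x. indicator {-R..R} x *\<^sub>R f x)"
    by (subst integrable_completion) auto
  then show "integrable lebesgue (\<lambda>x. indicator {-R..R} x * f x)"
    by simp
qed

lemma locally_integrable_diff:
  assumes "locally_integrable f" "locally_integrable g"
  shows "locally_integrable (\<lambda>x. f x - g x)"
  using locally_integrable_interval[OF assms(1)] locally_integrable_interval[OF assms(2)]
  by (intro locally_integrableI) (simp add: right_diff_distrib)

lemma continuous_compact_support_bounded:
  fixes q :: "real \<Rightarrow> real"
  assumes "continuous_on UNIV q" and "\<And>x. x \<notin> {a..b} \<Longrightarrow> q x = 0"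
  obtains C where "\<And>x. \<bar>q x\<bar> \<le> C"
proof -
  have "bounded (q ` {a..b})"
    by (intro compact_imp_bounded compact_continuous_image) (use assms(1) continuous_on_subset in auto)
  then obtain C where "C > 0" "\<And>x. x \<in> {a..b} \<Longrightarrow> \<bar>q x\<bar> \<le> C"
    unfolding bounded_pos by auto
  with assms(2) that show thesis
    by (metis abs_zero less_imp_le)
qed

lemma integrable_times_compact_support:
  assumes h: "locally_integrable h" and q: "continuous_on UNIV q"
    and supp: "\<And>x. x \<notin> {a..b} \<Longrightarrow> q x = 0"
  shows "integrable lebesgue (\<lambda>x. h x * q x)"
proof -
  obtain C where C: "\<And>x. \<bar>q x\<bar> \<le> C"
    using continuous_compact_support_bounded[OF q supp] by blast
  have "integrable lebesgue (\<lambda>x. (indicator {a..b} x * h x) * q x)"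
    by (rule integrable_lebesgue_bounded_mult[OF locally_integrable_interval[OF h]
          continuous_measurable_lebesgue[OF q] C])
  moreover have "(\<lambda>x. (indicator {a..b} x * h x) * q x) = (\<lambda>x. h x * q x)"
    using supp by (fastforce simp: indicator_def)
  ultimately show ?thesis
    by simp
qed

lemma integrable_times_test:
  assumes "locally_integrable h" "test_function \<eta>"
  shows "integrable lebesgue (\<lambda>x. h x * \<eta> x)"
proof -
  obtain R where "\<And>x. \<bar>x\<bar> \<ge> R \<Longrightarrow> \<eta> x = 0"
    using test_function_support[OF assms(2)] by blast
  then show ?thesis
    by (intro integrable_times_compact_support[OF assms(1) test_function_continuous[OF assms(2)],
          of "-R" R]) (auto simp: abs_le_iff)
qed

lemma integrable_test: "test_function \<eta> \<Longrightarrow> integrable lebesgue \<eta>"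
  using integrable_times_test[OF locally_integrable_continuous[OF continuous_on_const[of _ 1]]]
  by simp

text \<open>The open intervals form an intersection-stable generator of the Borel sets, so all set integrals
  of \<open>f\<close> vanish by a Dynkin system argument; Lebesgue sets differ from Borel sets by null sets.\<close>

lemma AE_zero_if_interval_integrals_zero:
  fixes f :: "real \<Rightarrow> real"
  assumes f: "integrable lebesgue f"
    and zero: "\<And>a b. (LINT x:{a<..<b}|lebesgue. f x) = 0"
  shows "AE x in lebesgue. f x = 0"
proof (rule density_unique_real[OF f integrable_zero])
  have int: "set_integrable lebesgue A f" if "A \<in> sets lebesgue" for A
    using integrable_mult_indicator[OF that f] by (simp add: set_integrable_def)
  have all: "(LINT x|lebesgue. f x) = 0"
  proof (rule LIMSEQ_unique)
    have "(\<lambda>n. LINT x:{- real n<..<real n}|lebesgue. f x) \<longlonglongrightarrow> (LINT x|lebesgue. f x)"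
      unfolding set_lebesgue_integral_def
    proof (rule integral_dominated_convergence)
      show "integrable lebesgue (\<lambda>x. \<bar>f x\<bar>)"
        using f by simp
      show "AE x in lebesgue. (\<lambda>n. indicator {- real n<..<real n} x *\<^sub>R f x) \<longlonglongrightarrow> f x"
      proof (rule AE_I2)
        fix x :: real
        obtain N where "\<bar>x\<bar> < real N"
          using reals_Archimedean2 by blast
        then have "eventually (\<lambda>n. indicator {- real n<..<real n} x *\<^sub>R f x = f x) sequentially"
          by (intro eventually_sequentiallyI[of N]) (auto simp: indicator_def)
        then show "(\<lambda>n. indicator {- real n<..<real n} x *\<^sub>R f x) \<longlonglongrightarrow> f x"
          by (rule tendsto_eventually)
      qed
      show "(\<lambda>x. indicator {- real n<..<real n} x *\<^sub>R f x) \<in> borel_measurable lebesgue" for n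
        using f by (intro borel_measurable_scaleR borel_measurable_indicator) auto
    qed (use f in \<open>auto simp: indicator_def\<close>)
    then show "(\<lambda>n. 0 :: real) \<longlonglongrightarrow> (LINT x|lebesgue. f x)"
      by (simp add: zero)
  qed simp
  have borel: "(LINT x:A|lebesgue. f x) = 0" if "A \<in> sets borel" for A
  proof -
    let ?G = "range (\<lambda>(a, b). {a<..<b::real})"
    have "sets (borel :: real measure) = sets (sigma UNIV ?G)"
      by (subst borel_eq_box) (simp add: box_real case_prod_unfold)
    then have borel_sets: "sets (borel :: real measure) = sigma_sets UNIV ?G"
      by simp
    have A: "A \<in> sigma_sets UNIV ?G"
      using that by (simp only: borel_sets)
    have stable: "Int_stable ?G"
    proof (rule Int_stableI)
      fix A B assume "A \<in> ?G" "B \<in> ?G"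
      then obtain a b c d where "A = {a<..<b}" "B = {c<..<d}"
        by auto
      then have "A \<inter> B = (\<lambda>(a, b). {a<..<b}) (max a c, min b d)"
        by auto
      then show "A \<inter> B \<in> ?G"
        by (metis rangeI)
    qed
    have "?G \<subseteq> Pow UNIV"
      by simp
    from stable this A show ?thesis
    proof (induction rule: sigma_sets_induct_disjoint)
      case (compl A)
      then have "A \<in> sets borel"
        by (simp only: borel_sets)
      then have A: "A \<in> sets lebesgue" "- A \<in> sets lebesgue"
        by auto
      have "(LINT x:A \<union> - A|lebesgue. f x) = (LINT x:A|lebesgue. f x) + (LINT x:- A|lebesgue. f x)"
        by (rule set_integral_Un) (use A int in auto)
      moreover have "(LINT x:A \<union> - A|lebesgue. f x) = 0"
        using all by (simp add: set_lebesgue_integral_def)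
      ultimately show ?case
        using compl by (simp add: Compl_eq_Diff_UNIV)
    next
      case (union A)
      then have A: "A i \<in> sets lebesgue" for i
        by (metis borel_sets range_subsetD sets_completionI_sets sets_lborel)
      have "(LINT x:(\<Union>i. A i)|lebesgue. f x) = (\<Sum>i. LINT x:A i|lebesgue. f x)"
        by (rule lebesgue_integral_countable_add)
          (use A union int in \<open>auto simp: disjoint_family_on_def\<close>)
      then show ?case
        using union by simp
    qed (use zero zero[of 1 0] in auto)
  qed
  fix A :: "real set" assume "A \<in> sets lebesgue"
  then obtain S N N' where A: "A = S \<union> N" "N \<subseteq> N'" "N' \<in> null_sets lborel" "S \<in> sets lborel"
    by (rule sets_completionE)
  have "AE x in lebesgue. x \<notin> N'"
    using A(3) by (simp add: AE_not_in null_sets_completionI)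
  then have "(LINT x:A|lebesgue. f x) = (LINT x:S|lebesgue. f x)"
    using \<open>A \<in> sets lebesgue\<close> A int[of A] int[of S]
    by (intro set_integral_cong_set)
      (auto simp: set_borel_measurable_def set_integrable_def elim: eventually_mono)
  then show "(LINT x:A|lebesgue. f x) = (LINT x:A|lebesgue. 0)"
    using borel[of S] A by simp
qed

text \<open>Dominated convergence along the plateau functions replaces the test function by the indicator of
  the interval.\<close>

lemma integral_Ioo_eq_zero_if_weakly_zero:
  assumes h: "locally_integrable h"
    and zero: "\<And>\<eta>. test_function \<eta> \<Longrightarrow> (LINT x|lebesgue. h x * \<eta> x) = 0"
  shows "(LINT x:{a<..<b}|lebesgue. h x) = 0"
proof (rule LIMSEQ_unique)
  let ?\<eta> = "\<lambda>n x. 1 - (1 - bump a b x) ^ n"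
  show "(\<lambda>n. LINT x|lebesgue. h x * ?\<eta> n x) \<longlonglongrightarrow> (LINT x:{a<..<b}|lebesgue. h x)"
    unfolding set_lebesgue_integral_def
  proof (rule integral_dominated_convergence)
    show "integrable lebesgue (\<lambda>x. \<bar>indicator {a..b} x * h x\<bar>)"
      using locally_integrable_interval[OF h] by (rule integrable_abs)
    show "AE x in lebesgue. (\<lambda>n. h x * ?\<eta> n x) \<longlonglongrightarrow> indicator {a<..<b} x *\<^sub>R h x"
    proof (rule AE_I2)
      fix x
      have "(\<lambda>n. (1 - bump a b x) ^ n) \<longlonglongrightarrow> 0" if "a < x \<and> x < b"
        using that bump_pos_iff[of a b x] bump_range[of a b x]
        by (intro LIMSEQ_power_zero) (auto simp: abs_if)
      then have "(\<lambda>n. h x * ?\<eta> n x) \<longlonglongrightarrow> h x * (1 - 0)" if "a < x \<and> x < b"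
        using that by (intro tendsto_mult tendsto_diff tendsto_const) auto
      moreover have "bump a b x = 0" if "\<not> (a < x \<and> x < b)"
        using that bump_pos_iff[of a b x] bump_range[of a b x] by auto
      ultimately show "(\<lambda>n. h x * ?\<eta> n x) \<longlonglongrightarrow> indicator {a<..<b} x *\<^sub>R h x"
        by (cases "a < x \<and> x < b") auto
    qed
    show "(\<lambda>x. h x * ?\<eta> n x) \<in> borel_measurable lebesgue" for n
      using integrable_times_test[OF h test_function_plateau] by blast
    then have "(\<lambda>x. indicator {a<..<b} x *\<^sub>R (indicator {a..b} x * h x)) \<in> borel_measurable lebesgue"
      using locally_integrable_interval[OF h, of a b]
      by (intro borel_measurable_scaleR borel_measurable_indicator) auto
    moreover have "(\<lambda>x. indicator {a<..<b} x *\<^sub>R (indicator {a..b} x * h x)) =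
        (\<lambda>x. indicator {a<..<b} x *\<^sub>R h x)"
      by (auto simp: indicator_def)
    ultimately show "(\<lambda>x. indicator {a<..<b} x *\<^sub>R h x) \<in> borel_measurable lebesgue"
      by simp
    show "AE x in lebesgue. norm (h x * ?\<eta> n x) \<le> \<bar>indicator {a..b} x * h x\<bar>" for n
    proof (rule AE_I2)
      fix x
      have "0 \<le> (1 - bump a b x) ^ n" "(1 - bump a b x) ^ n \<le> 1"
        using bump_range[of a b x] by (auto intro: power_le_one)
      then have "\<bar>?\<eta> n x\<bar> \<le> 1"
        by auto
      then have "\<bar>h x\<bar> * \<bar>?\<eta> n x\<bar> \<le> \<bar>h x\<bar> * 1"
        by (intro mult_left_mono) auto
      moreover have "?\<eta> n x = 0" if "x \<notin> {a..b}"
        using that bump_pos_iff[of a b x] bump_range[of a b x] by auto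
      ultimately show "norm (h x * ?\<eta> n x) \<le> \<bar>indicator {a..b} x * h x\<bar>"
        by (auto simp: indicator_def abs_mult)
    qed
  qed
  show "(\<lambda>n. LINT x|lebesgue. h x * ?\<eta> n x) \<longlonglongrightarrow> 0"
    by (simp add: zero[OF test_function_plateau])
qed

text \<open>Truncation to bounded intervals reduces this to integrable functions, for which the integrals over
  intervals determine the function.\<close>

lemma fundamental_lemma_calculus_of_variations:
  assumes h: "locally_integrable h"
    and zero: "\<And>\<eta>. test_function \<eta> \<Longrightarrow> (LINT x|lebesgue. h x * \<eta> x) = 0"
  shows "AE x in lebesgue. h x = 0"
proof -
  have "AE x in lebesgue. indicator {- real n..real n} x * h x = 0" for n
  proof (rule AE_zero_if_interval_integrals_zero)
    show "integrable lebesgue (\<lambda>x. indicator {- real n..real n} x * h x)"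
      by (rule locally_integrable_interval[OF h])
    fix a b :: real
    have "(LINT x:{a<..<b}|lebesgue. indicator {- real n..real n} x * h x) =
        (LINT x:{max a (- real n)<..<min b (real n)}|lebesgue. h x)"
      unfolding set_lebesgue_integral_def
    proof (rule integral_cong_AE)
      have *: "AE x in lebesgue. x \<notin> {- real n, real n}"
        by (intro AE_not_in null_sets_completionI) (auto intro: countable_imp_null_set_lborel)
      show "AE x in lebesgue. indicator {a<..<b} x *\<^sub>R (indicator {- real n..real n} x * h x) =
          indicator {max a (- real n)<..<min b (real n)} x *\<^sub>R h x"
        using * by eventually_elim (auto simp: indicator_def)
      show m: "(\<lambda>x. indicator {a<..<b} x *\<^sub>R (indicator {- real n..real n} x * h x))
          \<in> borel_measurable lebesgue"
        using locally_integrable_interval[OF h, of "- real n" "real n"]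
        by (intro borel_measurable_scaleR borel_measurable_indicator) auto
      have "(\<lambda>x. indicator {max a (- real n)<..<min b (real n)} x *\<^sub>R
          (indicator {- real n..real n} x * h x)) \<in> borel_measurable lebesgue"
        using locally_integrable_interval[OF h, of "- real n" "real n"]
        by (intro borel_measurable_scaleR borel_measurable_indicator) auto
      also have "(\<lambda>x. indicator {max a (- real n)<..<min b (real n)} x *\<^sub>R
          (indicator {- real n..real n} x * h x)) =
          (\<lambda>x. indicator {max a (- real n)<..<min b (real n)} x *\<^sub>R h x)"
        by (auto simp: indicator_def)
      finally show "(\<lambda>x. indicator {max a (- real n)<..<min b (real n)} x *\<^sub>R h x)
          \<in> borel_measurable lebesgue" .
    qed
    also have "\<dots> = 0"
      by (rule integral_Ioo_eq_zero_if_weakly_zero[OF h zero])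
    finally show "(LINT x:{a<..<b}|lebesgue. indicator {- real n..real n} x * h x) = 0" .
  qed
  then have "AE x in lebesgue. \<forall>n. indicator {- real n..real n} x * h x = 0"
    unfolding AE_all_countable ..
  then show ?thesis
  proof eventually_elim
    case (elim x)
    obtain n where "\<bar>x\<bar> < real n"
      using reals_Archimedean2 by blast
    then show ?case
      using elim[rule_format, of n] by (auto simp: indicator_def split: if_splits)
  qed
qed

section \<open>Weak and classical derivatives\<close>

lemma continuous_has_antiderivative:
  fixes q :: "real \<Rightarrow> real"
  assumes "continuous_on UNIV q"
  obtains Q where "\<And>x. (Q has_real_derivative q x) (at x)"
  using einterval_antiderivative[of "-\<infinity>" "\<infinity>" q] assms
  by (auto simp: continuous_on_eq_continuous_at has_real_derivative_iff_has_vector_derivative)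

lemma integral_FTC_compact_support:
  fixes q :: "real \<Rightarrow> real"
  assumes "a \<le> b" and deriv: "\<And>x. (Q has_real_derivative q x) (at x)"
    and q: "continuous_on UNIV q" and supp: "\<And>x. x \<notin> {a..b} \<Longrightarrow> q x = 0"
  shows "(LINT x|lebesgue. q x) = Q b - Q a"
proof -
  have "(LINT x|lborel. q x * indicator {a..b} x) = Q b - Q a"
    by (rule integral_FTC_Icc_real) (use assms in \<open>auto simp: continuous_on_eq_continuous_at\<close>)
  moreover have "(\<lambda>x. q x * indicator {a..b} x) = q"
    using supp by (fastforce simp: indicator_def)
  moreover have "(LINT x|lebesgue. q x) = (LINT x|lborel. q x)"
    by (rule integral_completion) (simp add: q borel_measurable_continuous_onI)
  ultimately show ?thesis
    by simp
qed

text \<open>The antiderivative that vanishes at the left end of the support is constant to the right of it,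
  and the constant is the total mass.\<close>

lemma test_function_antiderivative:
  assumes \<psi>: "test_function \<psi>" and "(LINT x|lebesgue. \<psi> x) = 0"
  obtains \<Psi> where "test_function \<Psi>" "deriv \<Psi> = \<psi>"
proof -
  obtain R where R: "R > 0" "\<And>x. \<bar>x\<bar> \<ge> R \<Longrightarrow> \<psi> x = 0"
    using test_function_support[OF \<psi>] by blast
  obtain Q where Q: "\<And>x. (Q has_real_derivative \<psi> x) (at x)"
    using continuous_has_antiderivative test_function_continuous[OF \<psi>] by blast
  define \<Psi> where "\<Psi> x = Q x - Q (- R)" for x
  have \<Psi>: "(\<Psi> has_real_derivative \<psi> x) (at x)" for x
    unfolding \<Psi>_def by (auto intro!: derivative_eq_intros Q)
  have "(LINT x|lebesgue. \<psi> x) = Q R - Q (- R)"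
    by (rule integral_FTC_compact_support)
      (use R Q test_function_continuous[OF \<psi>] in auto)
  with assms(2) have QR: "Q R = Q (- R)"
    by simp
  have right: "\<Psi> x = 0" if "x > R" for x
  proof -
    have "\<exists>z. R < z \<and> z < x \<and> Q x - Q R = (x - R) * \<psi> z"
      using MVT2[OF that, of Q \<psi>] Q by blast
    then show ?thesis
      using R QR by (auto simp: \<Psi>_def)
  qed
  have left: "\<Psi> x = 0" if "x < - R" for x
  proof -
    have "\<exists>z. x < z \<and> z < - R \<and> Q (- R) - Q x = (- R - x) * \<psi> z"
      using MVT2[OF that, of Q \<psi>] Q by blast
    then show ?thesis
      using R by (auto simp: \<Psi>_def)
  qed
  have "smooth \<Psi>"
    by (rule smooth_coinduct[of "\<lambda>g. g = \<Psi> \<or> smooth g"])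
      (use \<Psi> test_function_smooth[OF \<psi>] smooth_deriv smooth_has_deriv in blast)+
  then have "test_function \<Psi>"
    by (rule test_functionI[of _ "-R" R]) (use left right in \<open>auto simp: not_le\<close>)
  then show thesis
    using that \<Psi> DERIV_imp_deriv by blast
qed

lemma test_function_unit_mass:
  obtains \<eta> where "test_function \<eta>" "(LINT x|lebesgue. \<eta> x) = 1"
proof -
  have bump: "test_function (bump 0 1)"
    using test_function_plateau[of 0 1 1] by simp
  have "(LINT x|lebesgue. bump 0 1 x) \<noteq> 0"
  proof
    assume "(LINT x|lebesgue. bump 0 1 x) = 0"
    then have "AE x in lebesgue. bump 0 1 x = 0"
      using integral_nonneg_eq_0_iff_AE[OF integrable_test[OF bump]] bump_range by auto
    then have "AE x in lebesgue. x \<notin> {0<..<1::real}"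
      by eventually_elim (metis bump_pos_iff greaterThanLessThan_iff less_irrefl)
    then have "{0<..<1::real} \<in> null_sets lebesgue"
      by (subst AE_iff_null_sets) auto
    then have "emeasure lebesgue {0<..<1::real} = 0"
      by blast
    then show False
      by simp
  qed
  moreover have "test_function (\<lambda>x. (1 / c) * bump 0 1 x)" for c
  proof (rule test_functionI[of _ 0 1])
    show "smooth (\<lambda>x. (1 / c) * bump 0 1 x)"
      by (intro smooth_cmult smooth_bump)
    fix x :: real assume "x \<notin> {0..1}"
    then show "(1 / c) * bump 0 1 x = 0"
      using bump_pos_iff[of 0 1 x] bump_range[of 0 1 x] by auto
  qed
  ultimately show thesis
    using that[of "\<lambda>x. (1 / (LINT x|lebesgue. bump 0 1 x)) * bump 0 1 x"] by simp
qed

text \<open>A test function minus the multiple of \<open>\<eta>0\<close> with the same mass is a derivative of a test function, so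
  \<open>w\<close> acts on test functions as the constant \<open>c\<close> does.\<close>

lemma du_Bois_Reymond:
  assumes w: "locally_integrable w"
    and zero: "\<And>\<eta>. test_function \<eta> \<Longrightarrow> (LINT x|lebesgue. w x * deriv \<eta> x) = 0"
  obtains c where "AE x in lebesgue. w x = c"
proof -
  obtain \<eta>0 where \<eta>0: "test_function \<eta>0" "(LINT x|lebesgue. \<eta>0 x) = 1"
    using test_function_unit_mass by blast
  define c where "c = (LINT x|lebesgue. w x * \<eta>0 x)"
  have "AE x in lebesgue. w x - c = 0"
  proof (rule fundamental_lemma_calculus_of_variations)
    show "locally_integrable (\<lambda>x. w x - c)"
      by (intro locally_integrable_diff w locally_integrable_continuous continuous_on_const)
    fix \<eta> assume \<eta>: "test_function \<eta>"
    define m where "m = (LINT x|lebesgue. \<eta> x)"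
    define \<psi> where "\<psi> x = \<eta> x - m * \<eta>0 x" for x
    note int = integrable_test[OF \<eta>] integrable_test[OF \<eta>0(1)]
      integrable_times_test[OF w \<eta>] integrable_times_test[OF w \<eta>0(1)]
    have "test_function \<psi>"
    proof -
      obtain R where R: "\<And>x. \<bar>x\<bar> \<ge> R \<Longrightarrow> \<eta> x = 0"
        using test_function_support[OF \<eta>] by blast
      obtain R' where R': "\<And>x. \<bar>x\<bar> \<ge> R' \<Longrightarrow> \<eta>0 x = 0"
        using test_function_support[OF \<eta>0(1)] by blast
      show ?thesis
        unfolding \<psi>_def
      proof (rule test_functionI[of _ "- max R R'" "max R R'"])
        show "smooth (\<lambda>x. \<eta> x - m * \<eta>0 x)"
          by (intro smooth_diff smooth_cmult test_function_smooth \<eta> \<eta>0)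
        fix x assume "x \<notin> {- max R R'..max R R'}"
        then have "\<bar>x\<bar> \<ge> R" "\<bar>x\<bar> \<ge> R'"
          by auto
        then show "\<eta> x - m * \<eta>0 x = 0"
          using R R' by simp
      qed
    qed
    moreover have "(LINT x|lebesgue. \<psi> x) = 0"
      using int \<eta>0(2) by (simp add: \<psi>_def m_def)
    ultimately obtain \<Psi> where "test_function \<Psi>" "deriv \<Psi> = \<psi>"
      by (rule test_function_antiderivative)
    then have "0 = (LINT x|lebesgue. w x * \<psi> x)"
      using zero by force
    also have "\<dots> = (LINT x|lebesgue. w x * \<eta> x - m * (w x * \<eta>0 x))"
      by (rule Bochner_Integration.integral_cong) (auto simp: \<psi>_def algebra_simps)
    also have "\<dots> = (LINT x|lebesgue. w x * \<eta> x) - m * c"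
      using int by (simp add: c_def)
    also have "\<dots> = (LINT x|lebesgue. w x * \<eta> x - c * \<eta> x)"
      using int by (simp add: m_def)
    finally show "(LINT x|lebesgue. (w x - c) * \<eta> x) = 0"
      by (simp add: left_diff_distrib)
  qed
  then show thesis
    by (intro that[of c]) auto
qed

lemma integral_by_parts_test:
  assumes F: "\<And>x. (F has_real_derivative q x) (at x)" and q: "continuous_on UNIV q"
    and \<eta>: "test_function \<eta>"
  shows "(LINT x|lebesgue. F x * deriv \<eta> x) = - (LINT x|lebesgue. q x * \<eta> x)"
proof -
  have F_cont: "continuous_on UNIV F"
    by (rule continuous_on_if_deriv[OF F])
  obtain R where R: "R > 0" "\<And>x. \<bar>x\<bar> \<ge> R \<Longrightarrow> \<eta> x = 0"
    using test_function_support[OF \<eta>] by blast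
  obtain R' where R': "R' > 0" "\<And>x. \<bar>x\<bar> \<ge> R' \<Longrightarrow> deriv \<eta> x = 0"
    using test_function_support[OF test_function_deriv[OF \<eta>]] by blast
  note int = integrable_times_test[OF locally_integrable_continuous[OF F_cont] test_function_deriv[OF \<eta>]]
    integrable_times_test[OF locally_integrable_continuous[OF q] \<eta>]
  let ?m = "max R R'"
  have "(LINT x|lebesgue. q x * \<eta> x + F x * deriv \<eta> x) = F ?m * \<eta> ?m - F (- ?m) * \<eta> (- ?m)"
  proof (rule integral_FTC_compact_support[of "- ?m" ?m "\<lambda>x. F x * \<eta> x"])
    show "((\<lambda>x. F x * \<eta> x) has_real_derivative q x * \<eta> x + F x * deriv \<eta> x) (at x)" for x
      using DERIV_mult[OF F smooth_has_deriv[OF test_function_smooth[OF \<eta>]]]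
      by (simp add: mult.commute)
    show "continuous_on UNIV (\<lambda>x. q x * \<eta> x + F x * deriv \<eta> x)"
      by (intro continuous_intros q F_cont test_function_continuous \<eta> test_function_deriv)
  qed (use R R' in auto)
  also have "\<dots> = 0"
    using R by simp
  finally show ?thesis
    using int by simp
qed

lemma has_weak_deriv_1I:
  assumes F: "\<And>x. (F has_real_derivative q x) (at x)" and q: "continuous_on UNIV q"
  shows "has_weak_deriv 1 F q"
  unfolding has_weak_deriv_def
proof (intro conjI allI impI)
  show "locally_integrable F"
    by (rule locally_integrable_continuous[OF continuous_on_if_deriv[OF F]])
  show "locally_integrable q"
    by (rule locally_integrable_continuous[OF q])
qed (use integral_by_parts_test[OF F q] in simp)

lemma has_weak_deriv_2I:
  assumes F: "\<And>x. (F has_real_derivative q x) (at x)"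
    and q: "\<And>x. (q has_real_derivative r x) (at x)" and r: "continuous_on UNIV r"
  shows "has_weak_deriv 2 F r"
  unfolding has_weak_deriv_def
proof (intro conjI allI impI)
  have q_cont: "continuous_on UNIV q"
    by (rule continuous_on_if_deriv[OF q])
  show "locally_integrable F"
    by (rule locally_integrable_continuous[OF continuous_on_if_deriv[OF F]])
  show "locally_integrable r"
    by (rule locally_integrable_continuous[OF r])
  fix \<eta> assume \<eta>: "test_function \<eta>"
  show "(LINT x|lebesgue. F x * (deriv ^^ 2) \<eta> x) = (- 1)\<^sup>2 * (LINT x|lebesgue. r x * \<eta> x)"
    using integral_by_parts_test[OF F q_cont test_function_deriv[OF \<eta>]]
      integral_by_parts_test[OF q r \<eta>]
    by (simp add: numeral_2_eq_2)
qed

lemma has_weak_deriv_2D: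
  assumes "has_weak_deriv 1 f g" "has_weak_deriv 2 f h"
  shows "has_weak_deriv 1 g h"
  unfolding has_weak_deriv_def
proof (intro conjI allI impI)
  show "locally_integrable g" "locally_integrable h"
    using assms by (auto simp: has_weak_deriv_def)
  fix \<eta> assume \<eta>: "test_function \<eta>"
  have "(LINT x|lebesgue. f x * deriv (deriv \<eta>) x) = - (LINT x|lebesgue. g x * deriv \<eta> x)"
    using assms(1) test_function_deriv[OF \<eta>] by (auto simp: has_weak_deriv_def)
  moreover have "(LINT x|lebesgue. f x * deriv (deriv \<eta>) x) = (LINT x|lebesgue. h x * \<eta> x)"
    using assms(2) \<eta> by (auto simp: has_weak_deriv_def numeral_2_eq_2)
  ultimately show "(LINT x|lebesgue. g x * (deriv ^^ 1) \<eta> x) = (- 1) ^ 1 * (LINT x|lebesgue. h x * \<eta> x)"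
    by simp
qed

lemma weak_deriv_determines_up_to_constant:
  assumes f: "has_weak_deriv 1 f g" and F: "has_weak_deriv 1 F q"
    and eq: "AE x in lebesgue. g x = q x"
  obtains c where "AE x in lebesgue. f x = F x + c"
proof -
  have li: "locally_integrable f" "locally_integrable F" "locally_integrable g" "locally_integrable q"
    using f F by (auto simp: has_weak_deriv_def)
  obtain c where "AE x in lebesgue. f x - F x = c"
  proof (rule du_Bois_Reymond)
    show "locally_integrable (\<lambda>x. f x - F x)"
      by (intro locally_integrable_diff li)
    fix \<eta> assume \<eta>: "test_function \<eta>"
    note \<eta>' = test_function_deriv[OF \<eta>]
    have "(LINT x|lebesgue. f x * deriv \<eta> x) = - (LINT x|lebesgue. g x * \<eta> x)"
      using f \<eta> by (auto simp: has_weak_deriv_def)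
    also have "(LINT x|lebesgue. g x * \<eta> x) = (LINT x|lebesgue. q x * \<eta> x)"
      using eq integrable_times_test[OF li(3) \<eta>] integrable_times_test[OF li(4) \<eta>]
      by (intro integral_cong_AE) (auto elim: eventually_mono)
    also have "- \<dots> = (LINT x|lebesgue. F x * deriv \<eta> x)"
      using F \<eta> by (auto simp: has_weak_deriv_def)
    finally show "(LINT x|lebesgue. (f x - F x) * deriv \<eta> x) = 0"
      using integrable_times_test[OF li(1) \<eta>'] integrable_times_test[OF li(2) \<eta>']
      by (simp add: left_diff_distrib)
  qed
  then show thesis
    by (intro that[of c]) (auto elim: eventually_mono)
qed

text \<open>With a continuous weak derivative \<open>q\<close>, the function differs from a classical antiderivative of \<open>q\<close>
  by a constant.\<close>

lemma weak_deriv_continuous_imp_C1: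
  assumes f: "has_weak_deriv 1 f g" and q: "continuous_on UNIV q"
    and eq: "AE x in lebesgue. g x = q x"
  obtains F where "\<And>x. (F has_real_derivative q x) (at x)" "AE x in lebesgue. f x = F x"
proof -
  obtain Q where Q: "\<And>x. (Q has_real_derivative q x) (at x)"
    using continuous_has_antiderivative[OF q] by blast
  obtain c where "AE x in lebesgue. f x = Q x + c"
    using weak_deriv_determines_up_to_constant[OF f has_weak_deriv_1I[OF Q q] eq] by blast
  then show thesis
    by (intro that[of "\<lambda>x. Q x + c"]) (auto intro!: derivative_eq_intros Q)
qed

lemma AE_eq_continuous_imp_eq:
  fixes f g :: "real \<Rightarrow> real"
  assumes ae: "AE x in lebesgue. f x = g x" and "continuous_on UNIV f" "continuous_on UNIV g"
  shows "f = g"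
proof (rule ccontr)
  assume "f \<noteq> g"
  let ?U = "{x. f x \<noteq> g x}"
  have "open ?U"
    using assms(2,3) by (rule open_Collect_neq)
  moreover have "?U \<noteq> {}"
    using \<open>f \<noteq> g\<close> by auto
  moreover have "?U \<in> null_sets lebesgue"
    using ae \<open>open ?U\<close> by (subst AE_iff_null_sets) auto
  ultimately show False
    using open_not_negligible[of ?U] by (simp add: negligible_iff_null_sets)
qed

section \<open>Primitives of locally integrable functions\<close>

lemma sigma_finite_lebesgue: "sigma_finite_measure (lebesgue :: real measure)"
proof
  show "\<exists>A. countable A \<and> A \<subseteq> sets (lebesgue :: real measure) \<and> \<Union> A = space lebesgue \<and>
      (\<forall>a\<in>A. emeasure lebesgue a \<noteq> \<infinity>)"
  proof (intro exI[of _ "range (\<lambda>n. {- real n..real n})"] conjI)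
    show "\<Union> (range (\<lambda>n. {- real n..real n})) = space lebesgue"
    proof -
      have "\<exists>n. - real n \<le> x \<and> x \<le> real n" for x
        by (metis abs_le_iff minus_le_iff real_arch_simple)
      then show ?thesis
        by auto
    qed
  qed auto
qed

text \<open>The indicator of \<open>[0, x]\<close> with the sign of an oriented integral, written as a kernel so that
  Fubini's theorem applies to \<open>primitive\<close>. At \<open>t = 0\<close> the first case is preferred, which makes the
  kernel in \<open>x\<close> the indicator of \<open>[t, \<infinity>)\<close> for all \<open>t \<ge> 0\<close>, including \<open>0\<close>.\<close>

definition primitive_kernel :: "real \<Rightarrow> real \<Rightarrow> real" where
  "primitive_kernel t x = (if 0 \<le> t \<and> t \<le> x then 1 else if x \<le> t \<and> t < 0 then -1 else 0)"

definition primitive :: "(real \<Rightarrow> real) \<Rightarrow> real \<Rightarrow> real" where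
  "primitive g x = (LINT t|lebesgue. g t * primitive_kernel t x)"

lemma primitive_kernel_abs_le: "\<bar>primitive_kernel t x\<bar> \<le> 1"
  by (simp add: primitive_kernel_def)

lemma primitive_kernel_measurable: "(\<lambda>t. primitive_kernel t x) \<in> borel_measurable lebesgue"
proof -
  have "(\<lambda>t. primitive_kernel t x) \<in> borel_measurable borel"
    unfolding primitive_kernel_def by measurable
  then show ?thesis
    by (simp add: measurable_completion)
qed

lemma primitive_kernel_truncate:
  assumes "\<bar>x\<bar> \<le> R"
  shows "g t * primitive_kernel t x = indicator {-R..R} t * g t * primitive_kernel t x"
  using assms by (auto simp: primitive_kernel_def indicator_def)

lemma continuous_primitive:
  assumes g: "locally_integrable g"
  shows "continuous_on UNIV (primitive g)"
  unfolding continuous_on_eq_continuous_at[OF open_UNIV] continuous_at_sequentially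
proof (intro ballI allI impI)
  fix x and X :: "nat \<Rightarrow> real" assume X: "X \<longlonglongrightarrow> x"
  then obtain R where R: "\<And>n. \<bar>X n\<bar> \<le> R"
    by (metis convergentI convergent_imp_Bseq Bseq_def real_norm_def)
  have xR: "\<bar>x\<bar> \<le> R"
    by (rule LIMSEQ_le_const2[OF tendsto_rabs[OF X]]) (use R in auto)
  have meas: "(\<lambda>t. indicator {-R..R} t * g t * primitive_kernel t y) \<in> borel_measurable lebesgue" for y
    using locally_integrable_interval[OF g, of "-R" R] primitive_kernel_measurable
    by (intro borel_measurable_times[OF _ primitive_kernel_measurable]) auto
  have "(\<lambda>n. LINT t|lebesgue. indicator {-R..R} t * g t * primitive_kernel t (X n)) \<longlonglongrightarrow>
      (LINT t|lebesgue. indicator {-R..R} t * g t * primitive_kernel t x)"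
  proof (rule integral_dominated_convergence)
    show "integrable lebesgue (\<lambda>t. \<bar>indicator {-R..R} t * g t\<bar>)"
      using locally_integrable_interval[OF g] by (rule integrable_abs)
    have "AE t in lebesgue. t \<notin> {0, x}"
      by (intro AE_not_in null_sets_completionI) (auto intro: countable_imp_null_set_lborel)
    then show "AE t in lebesgue. (\<lambda>n. indicator {-R..R} t * g t * primitive_kernel t (X n)) \<longlonglongrightarrow>
        indicator {-R..R} t * g t * primitive_kernel t x"
    proof eventually_elim
      case (elim t)
      then have "t < x \<or> x < t"
        by auto
      then have "eventually (\<lambda>n. primitive_kernel t (X n) = primitive_kernel t x) sequentially"
      proof
        assume "t < x"
        then show ?thesis
          using order_tendstoD(1)[OF X \<open>t < x\<close>]
          by (auto elim!: eventually_mono simp: primitive_kernel_def)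
      next
        assume "x < t"
        then show ?thesis
          using order_tendstoD(2)[OF X \<open>x < t\<close>]
          by (auto elim!: eventually_mono simp: primitive_kernel_def)
      qed
      then have "(\<lambda>n. primitive_kernel t (X n)) \<longlonglongrightarrow> primitive_kernel t x"
        by (rule tendsto_eventually)
      then show ?case
        by (intro tendsto_mult tendsto_const)
    qed
    show "AE t in lebesgue. norm (indicator {-R..R} t * g t * primitive_kernel t (X n))
        \<le> \<bar>indicator {-R..R} t * g t\<bar>" for n
      by (intro AE_I2) (simp add: abs_mult mult_left_le primitive_kernel_abs_le)
  qed (rule meas)+
  moreover have "primitive g y = (LINT t|lebesgue. indicator {-R..R} t * g t * primitive_kernel t y)"
    if "\<bar>y\<bar> \<le> R" for y
    unfolding primitive_def primitive_kernel_truncate[OF that, symmetric] ..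
  ultimately show "(primitive g \<circ> X) \<longlonglongrightarrow> primitive g x"
    using R xR by (simp add: o_def)
qed

lemma integral_primitive_kernel_deriv_test:
  assumes \<eta>: "test_function \<eta>"
  shows "(LINT x|lebesgue. primitive_kernel t x * deriv \<eta> x) = - \<eta> t"
proof -
  obtain R where R: "R > 0" "\<And>x. \<bar>x\<bar> \<ge> R \<Longrightarrow> \<eta> x = 0"
    using test_function_support[OF \<eta>] by blast
  obtain R' where R': "R' > 0" "\<And>x. \<bar>x\<bar> \<ge> R' \<Longrightarrow> deriv \<eta> x = 0"
    using test_function_support[OF test_function_deriv[OF \<eta>]] by blast
  define m where "m = Max {R, R', \<bar>t\<bar>}"
  have m: "R \<le> m" "R' \<le> m" "\<bar>t\<bar> \<le> m"
    by (auto simp: m_def)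
  have FTC: "(LINT x|lebesgue. deriv \<eta> x * indicator {a..b} x) = \<eta> b - \<eta> a" if "a \<le> b" for a b
  proof -
    have "(LINT x|lborel. deriv \<eta> x * indicator {a..b} x) = \<eta> b - \<eta> a"
      by (rule integral_FTC_Icc_real)
        (use that smooth_has_deriv[OF test_function_smooth[OF \<eta>]]
          test_function_continuous[OF test_function_deriv[OF \<eta>], of UNIV]
          in \<open>auto simp: continuous_on_eq_continuous_at\<close>)
    moreover have "(\<lambda>x. deriv \<eta> x * indicator {a..b} x) \<in> borel_measurable lborel"
    proof (intro borel_measurable_times borel_measurable_indicator)
      show "deriv \<eta> \<in> borel_measurable lborel"
        using test_function_continuous[OF test_function_deriv[OF \<eta>], of UNIV]
        by (simp add: borel_measurable_continuous_onI)
    qed simp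
    ultimately show ?thesis
      by (simp add: integral_completion)
  qed
  show ?thesis
  proof (cases "t \<ge> 0")
    case True
    have "(LINT x|lebesgue. primitive_kernel t x * deriv \<eta> x) =
        (LINT x|lebesgue. deriv \<eta> x * indicator {t..m} x)"
      by (rule Bochner_Integration.integral_cong)
        (use True R' m in \<open>auto simp: primitive_kernel_def indicator_def\<close>)
    also have "\<dots> = - \<eta> t"
      using FTC[of t m] m R by simp
    finally show ?thesis .
  next
    case False
    have "(LINT x|lebesgue. primitive_kernel t x * deriv \<eta> x) =
        (LINT x|lebesgue. - (deriv \<eta> x * indicator {-m..t} x))"
      by (rule Bochner_Integration.integral_cong)
        (use False R' m in \<open>auto simp: primitive_kernel_def indicator_def\<close>)
    also have "\<dots> = - \<eta> t"
      using FTC[of "-m" t] m R by simp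
    finally show ?thesis .
  qed
qed

text \<open>Exchanging the order of integration moves the derivative onto the kernel. The truncation \<open>gm\<close> of \<open>g\<close>
  to an interval containing the supports makes the double integral absolutely convergent.\<close>

lemma has_weak_deriv_primitive:
  assumes g: "locally_integrable g"
  shows "has_weak_deriv 1 (primitive g) g"
  unfolding has_weak_deriv_def
proof (intro conjI allI impI)
  show "locally_integrable (primitive g)"
    by (rule locally_integrable_continuous[OF continuous_primitive[OF g]])
  show "locally_integrable g"
    by (rule g)
  fix \<eta> assume \<eta>: "test_function \<eta>"
  note \<eta>' = test_function_deriv[OF \<eta>]
  obtain R where R: "\<And>x. \<bar>x\<bar> \<ge> R \<Longrightarrow> deriv \<eta> x = 0"
    using test_function_support[OF \<eta>'] by blast
  obtain R0 where R0: "\<And>x. \<bar>x\<bar> \<ge> R0 \<Longrightarrow> \<eta> x = 0"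
    using test_function_support[OF \<eta>] by blast
  define m where "m = max R R0"
  define gm where "gm t = indicator {-m..m} t * g t" for t
  have gm: "integrable lebesgue gm"
    unfolding gm_def by (rule locally_integrable_interval[OF g])
  interpret L: sigma_finite_measure "lebesgue :: real measure"
    by (rule sigma_finite_lebesgue)
  interpret LL: pair_sigma_finite "lebesgue :: real measure" "lebesgue :: real measure" ..
  let ?P = "lebesgue \<Otimes>\<^sub>M lebesgue :: (real \<times> real) measure"
  let ?f = "\<lambda>p. gm (fst p) * (deriv \<eta> (snd p) * primitive_kernel (fst p) (snd p))"
  have id: "(\<lambda>x. x) \<in> measurable lebesgue (borel :: real measure)"
    by (simp add: measurable_completion)
  have [measurable]: "fst \<in> measurable ?P borel" "snd \<in> measurable ?P borel"
    using measurable_compose[OF measurable_fst id] measurable_compose[OF measurable_snd id]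
    by (auto simp: comp_def)
  have ker: "(\<lambda>p. primitive_kernel (fst p) (snd p)) \<in> borel_measurable ?P"
    unfolding primitive_kernel_def by measurable
  have gmP: "(\<lambda>p. gm (fst p)) \<in> borel_measurable ?P" "(\<lambda>p. deriv \<eta> (snd p)) \<in> borel_measurable ?P"
    using gm integrable_test[OF \<eta>']
    by (auto intro: measurable_compose[OF measurable_fst] measurable_compose[OF measurable_snd])
  have prod: "integrable ?P (\<lambda>p. gm (fst p) * deriv \<eta> (snd p))"
  proof (rule LL.Fubini_integrable)
    show "(\<lambda>p. gm (fst p) * deriv \<eta> (snd p)) \<in> borel_measurable ?P"
      by (intro borel_measurable_times gmP)
    show "integrable lebesgue (\<lambda>x. LINT y|lebesgue. norm (gm (fst (x, y)) * deriv \<eta> (snd (x, y))))"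
      using gm by (simp add: abs_mult)
    show "AE x in lebesgue. integrable lebesgue (\<lambda>y. gm (fst (x, y)) * deriv \<eta> (snd (x, y)))"
      using integrable_test[OF \<eta>'] by simp
  qed
  have "integrable ?P ?f"
  proof (rule Bochner_Integration.integrable_bound[OF prod])
    show "?f \<in> borel_measurable ?P"
      by (intro borel_measurable_times gmP ker)
    show "AE p in ?P. norm (?f p) \<le> norm (gm (fst p) * deriv \<eta> (snd p))"
      by (intro AE_I2) (auto simp: abs_mult primitive_kernel_abs_le intro!: mult_left_mono mult_left_le)
  qed
  then have "integrable ?P (\<lambda>(t, x). gm t * (deriv \<eta> x * primitive_kernel t x))"
    by (simp add: case_prod_unfold)
  note Fubini = LL.Fubini_integral[OF this]
  have "(LINT x|lebesgue. primitive g x * deriv \<eta> x) =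
      (LINT x|lebesgue. LINT t|lebesgue. gm t * (deriv \<eta> x * primitive_kernel t x))"
  proof (rule Bochner_Integration.integral_cong)
    fix x :: real
    show "primitive g x * deriv \<eta> x = (LINT t|lebesgue. gm t * (deriv \<eta> x * primitive_kernel t x))"
    proof (cases "\<bar>x\<bar> \<le> m")
      case True
      have "primitive g x * deriv \<eta> x = (LINT t|lebesgue. deriv \<eta> x * (g t * primitive_kernel t x))"
        by (simp add: primitive_def mult.commute)
      also have "\<dots> = (LINT t|lebesgue. gm t * (deriv \<eta> x * primitive_kernel t x))"
        by (rule Bochner_Integration.integral_cong)
          (simp_all add: primitive_kernel_truncate[OF True, of g] gm_def mult_ac)
      finally show ?thesis .
    next
      case False
      then have "deriv \<eta> x = 0"
        by (intro R) (simp add: m_def)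
      then show ?thesis
        by simp
    qed
  qed simp
  also have "\<dots> = (LINT t|lebesgue. LINT x|lebesgue. gm t * (deriv \<eta> x * primitive_kernel t x))"
    by (rule Fubini)
  also have "\<dots> = (LINT t|lebesgue. gm t * (- \<eta> t))"
    using integral_primitive_kernel_deriv_test[OF \<eta>] by (simp add: mult.commute)
  also have "\<dots> = (LINT t|lebesgue. - (g t * \<eta> t))"
  proof (rule Bochner_Integration.integral_cong)
    fix t :: real
    show "gm t * (- \<eta> t) = - (g t * \<eta> t)"
    proof (cases "t \<in> {-m..m}")
      case False
      then have "\<eta> t = 0"
        by (intro R0) (auto simp: m_def)
      then show ?thesis
        by simp
    qed (simp add: gm_def)
  qed simp
  finally show "(LINT x|lebesgue. primitive g x * (deriv ^^ 1) \<eta> x) =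
      (- 1) ^ 1 * (LINT x|lebesgue. g x * \<eta> x)"
    by simp
qed

text \<open>Compare with the primitive of the weak derivative, which is continuous even though that derivative
  is merely locally integrable.\<close>

lemma weak_deriv_imp_AE_continuous:
  assumes "has_weak_deriv 1 f g"
  obtains F where "continuous_on UNIV F" "AE x in lebesgue. f x = F x"
proof -
  have g: "locally_integrable g"
    using assms by (simp add: has_weak_deriv_def)
  obtain c where "AE x in lebesgue. f x = primitive g x + c"
    using weak_deriv_determines_up_to_constant[OF assms has_weak_deriv_primitive[OF g]] by auto
  moreover have "continuous_on UNIV (\<lambda>x. primitive g x + c)"
    by (intro continuous_intros continuous_primitive g)
  ultimately show thesis
    by (rule that[rotated])
qed

section \<open>Square-integrable functions, decay and regularity\<close>

lemma L2_dominated: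
  assumes "F \<in> borel_measurable lebesgue" "integrable lebesgue g" "\<And>x. (F x)\<^sup>2 \<le> g x"
  shows "F \<in> L2"
proof -
  have "integrable lebesgue (\<lambda>x. (F x)\<^sup>2)"
    by (rule Bochner_Integration.integrable_bound[OF assms(2)])
      (use assms in \<open>auto intro!: borel_measurable_power intro: order_trans[OF _ abs_ge_self]\<close>)
  with assms(1) show ?thesis
    by (simp add: L2_def)
qed

lemma L2_AE_cong:
  assumes "AE x in lebesgue. f x = F x" "f \<in> L2" "F \<in> borel_measurable lebesgue"
  shows "F \<in> L2"
proof -
  have "integrable lebesgue (\<lambda>x. (F x)\<^sup>2)"
    by (rule integrable_cong_AE_imp[of _ "\<lambda>x. (f x)\<^sup>2"])
      (use assms in \<open>auto simp: L2_def intro!: borel_measurable_power elim: eventually_mono\<close>)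
  with assms(3) show ?thesis
    by (simp add: L2_def)
qed

lemma L2_mult_integrable:
  assumes "f \<in> L2" "g \<in> L2"
  shows "integrable lebesgue (\<lambda>x. f x * g x)"
proof (rule Bochner_Integration.integrable_bound)
  show "integrable lebesgue (\<lambda>x. (f x)\<^sup>2 + (g x)\<^sup>2)"
    using assms by (auto simp: L2_def)
  show "(\<lambda>x. f x * g x) \<in> borel_measurable lebesgue"
    using assms by (auto simp: L2_def)
  have "\<bar>a * b\<bar> \<le> a\<^sup>2 + b\<^sup>2" for a b :: real
  proof -
    have "2 * (\<bar>a\<bar> * \<bar>b\<bar>) \<le> a\<^sup>2 + b\<^sup>2"
      using sum_squares_bound[of "\<bar>a\<bar>" "\<bar>b\<bar>"] by (simp add: mult.assoc)
    moreover have "0 \<le> \<bar>a\<bar> * \<bar>b\<bar>"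
      by simp
    ultimately show ?thesis
      unfolding abs_mult by linarith
  qed
  then show "AE x in lebesgue. norm (f x * g x) \<le> norm ((f x)\<^sup>2 + (g x)\<^sup>2)"
    by simp
qed

lemma L2_cmult: "f \<in> L2 \<Longrightarrow> (\<lambda>x. c * f x) \<in> L2"
  by (auto simp: L2_def power_mult_distrib)

lemma L2_add:
  assumes "f \<in> L2" "g \<in> L2"
  shows "(\<lambda>x. f x + g x) \<in> L2"
proof (rule L2_dominated)
  show "integrable lebesgue (\<lambda>x. 2 * (f x)\<^sup>2 + 2 * (g x)\<^sup>2)"
    using assms by (auto simp: L2_def)
  show "(f x + g x)\<^sup>2 \<le> 2 * (f x)\<^sup>2 + 2 * (g x)\<^sup>2" for x
    using sum_squares_bound[of "f x" "g x"] by (simp add: power2_sum)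
qed (use assms in \<open>auto simp: L2_def\<close>)

lemma L2_diff: "f \<in> L2 \<Longrightarrow> g \<in> L2 \<Longrightarrow> (\<lambda>x. f x - g x) \<in> L2"
  using L2_add[OF _ L2_cmult[of g "-1"]] by simp

lemma L2_sum: "(\<And>i. i \<in> A \<Longrightarrow> f i \<in> L2) \<Longrightarrow> (\<lambda>x. \<Sum>i\<in>A. f i x) \<in> L2"
proof (induction A rule: infinite_finite_induct)
  case (insert i A)
  then show ?case
    using L2_add[of "f i" "\<lambda>x. \<Sum>i\<in>A. f i x"] by auto
qed (auto simp: L2_def)

lemma L2_bounded_mult:
  assumes "f \<in> L2" "continuous_on UNIV g" "\<And>x. \<bar>g x\<bar> \<le> C"
  shows "(\<lambda>x. g x * f x) \<in> L2"
proof (rule L2_dominated)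
  show "integrable lebesgue (\<lambda>x. C\<^sup>2 * (f x)\<^sup>2)"
    using assms by (auto simp: L2_def)
  show "(\<lambda>x. g x * f x) \<in> borel_measurable lebesgue"
    using assms continuous_measurable_lebesgue[OF assms(2)]
    by (intro borel_measurable_times) (auto simp: L2_def)
  show "(g x * f x)\<^sup>2 \<le> C\<^sup>2 * (f x)\<^sup>2" for x
    unfolding power_mult_distrib
    by (intro mult_right_mono) (use assms(3) abs_le_square_iff[of "g x" C]
        order_trans[OF assms(3) abs_ge_self] in auto)
qed

lemma set_integral_FTC_Icc:
  assumes F: "\<And>x. (F has_real_derivative q x) (at x)" and q: "continuous_on UNIV q" and "a \<le> b"
  shows "(LINT t:{a..b}|lebesgue. q t) = F b - F a"
proof -
  have "(LINT x|lborel. q x * indicator {a..b} x) = F b - F a"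
    by (rule integral_FTC_Icc_real) (use assms in \<open>auto simp: continuous_on_eq_continuous_at\<close>)
  moreover have "(\<lambda>x. q x * indicator {a..b} x) \<in> borel_measurable lborel"
  proof (intro borel_measurable_times borel_measurable_indicator)
    show "q \<in> borel_measurable lborel"
      using q by (simp add: borel_measurable_continuous_onI)
  qed simp
  ultimately show ?thesis
    by (simp add: set_lebesgue_integral_def integral_completion mult.commute)
qed

definition tail_integral :: "(real \<Rightarrow> real) \<Rightarrow> real \<Rightarrow> real" where
  "tail_integral q x = (LINT t:{x..}|lebesgue. q t)"

lemma antiderivative_tendsto_at_top:
  assumes F: "\<And>x. (F has_real_derivative q x) (at x)" and q: "continuous_on UNIV q"
    and int: "integrable lebesgue q"
  shows "(F \<longlongrightarrow> F x + tail_integral q x) at_top"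
proof -
  have "set_integrable lebesgue {x..} q"
    using integrable_mult_indicator[OF _ int] by (simp add: set_integrable_def)
  then have "((\<lambda>b. F x + (LINT t:{x..b}|lebesgue. q t)) \<longlongrightarrow> F x + tail_integral q x) at_top"
    unfolding tail_integral_def
    by (intro tendsto_add tendsto_const tendsto_set_lebesgue_integral_at_top) auto
  then show ?thesis
  proof (rule Lim_transform_eventually)
    show "eventually (\<lambda>b. F x + (LINT t:{x..b}|lebesgue. q t) = F b) at_top"
      using eventually_ge_at_top[of x] by eventually_elim (simp add: set_integral_FTC_Icc[OF F q])
  qed
qed

lemma tail_integral_abs_le:
  assumes int: "integrable lebesgue q"
  shows "\<bar>tail_integral q x\<bar> \<le> (LINT t|lebesgue. \<bar>q t\<bar>)"
proof -
  have 1: "integrable lebesgue (\<lambda>t. indicator {x..} t * q t)"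
    using integrable_mult_indicator[OF _ int, of "{x..}"] by simp
  have "\<bar>tail_integral q x\<bar> \<le> (LINT t|lebesgue. \<bar>indicator {x..} t * q t\<bar>)"
    unfolding tail_integral_def set_lebesgue_integral_def real_scaleR_def
    by (rule integral_abs_bound)
  also have "\<dots> \<le> (LINT t|lebesgue. \<bar>q t\<bar>)"
    by (rule integral_mono[OF integrable_abs[OF 1] integrable_abs[OF int]])
      (simp add: indicator_def)
  finally show ?thesis .
qed

lemma tail_integral_has_deriv:
  assumes q: "continuous_on UNIV q" and int: "integrable lebesgue q"
  shows "(tail_integral q has_real_derivative - q x) (at x)"
    and "(tail_integral q \<longlongrightarrow> 0) at_top"
proof -
  obtain F where F: "\<And>x. (F has_real_derivative q x) (at x)"
    using continuous_has_antiderivative[OF q] by blast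
  note lim = antiderivative_tendsto_at_top[OF F q int]
  have "F x + tail_integral q x = F 0 + tail_integral q 0" for x
    by (rule tendsto_unique[OF _ lim[of x] lim[of 0]]) simp
  then have eq: "tail_integral q = (\<lambda>x. (F 0 + tail_integral q 0) - F x)"
    by (intro ext) (simp only: eq_diff_eq add.commute)
  show "(tail_integral q has_real_derivative - q x) (at x)"
    by (subst eq) (auto intro!: derivative_eq_intros F)
  show "(tail_integral q \<longlongrightarrow> 0) at_top"
    using tendsto_diff[OF tendsto_const[of "F 0 + tail_integral q 0"] lim[of 0]]
    by (subst eq) simp
qed

text \<open>With a positive limit the integral would grow linearly with the length of the interval.\<close>

lemma integrable_nonneg_limit_eq_0:
  fixes f :: "real \<Rightarrow> real"
  assumes int: "integrable lebesgue f" and nonneg: "\<And>x. 0 \<le> f x" and lim: "(f \<longlongrightarrow> l) at_top"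
  shows "l = 0"
proof (rule ccontr)
  assume "l \<noteq> 0"
  have "0 \<le> l"
    by (rule tendsto_lowerbound[OF lim]) (use nonneg in auto)
  with \<open>l \<noteq> 0\<close> have "eventually (\<lambda>x. l / 2 < f x) at_top"
    by (intro order_tendstoD(1)[OF lim]) simp
  then obtain X where X: "\<And>x. x \<ge> X \<Longrightarrow> l / 2 < f x"
    by (auto simp: eventually_at_top_linorder)
  have "(l / 2) * r \<le> (LINT x|lebesgue. f x)" if "r \<ge> 0" for r
  proof -
    have "(l / 2) * r = (LINT x|lebesgue. indicator {X..X + r} x * (l / 2))"
      using that by simp
    also have "\<dots> \<le> (LINT x|lebesgue. f x)"
    proof (rule integral_mono)
      show "integrable lebesgue (\<lambda>x. indicator {X..X + r} x * (l / 2))"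
        by (intro integrable_mult_left integrable_real_indicator) (auto simp: emeasure_lborel_Icc_eq)
      show "indicator {X..X + r} x * (l / 2) \<le> f x" for x
        using X[of x] nonneg[of x] by (auto simp: indicator_def)
    qed (rule int)
    finally show ?thesis .
  qed
  from this[of "2 * (\<bar>LINT x|lebesgue. f x\<bar> + 1) / l"]
  have "\<bar>LINT x|lebesgue. f x\<bar> + 1 \<le> (LINT x|lebesgue. f x)"
    using \<open>0 \<le> l\<close> \<open>l \<noteq> 0\<close> by simp
  then show False
    by linarith
qed

text \<open>The derivative \<open>2 F G\<close> of \<open>F\<^sup>2\<close> is integrable, so \<open>F\<^sup>2\<close> is bounded and has a limit at infinity, which
  is \<open>0\<close> since \<open>F\<^sup>2\<close> is integrable.\<close>

lemma L2_deriv_L2_decay: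
  assumes F: "\<And>x. (F has_real_derivative G x) (at x)" and G: "continuous_on UNIV G"
    and "F \<in> L2" "G \<in> L2"
  shows "(F \<longlongrightarrow> 0) at_top" and "\<exists>B. \<forall>x. \<bar>F x\<bar> \<le> B"
proof -
  let ?q = "\<lambda>x. 2 * F x * G x"
  have F_cont: "continuous_on UNIV F"
    by (rule continuous_on_if_deriv[OF F])
  have D: "((\<lambda>x. (F x)\<^sup>2) has_real_derivative ?q x) (at x)" for x
    by (auto intro!: derivative_eq_intros F)
  have q: "continuous_on UNIV ?q"
    by (intro continuous_intros F_cont G)
  have int: "integrable lebesgue ?q"
    using L2_mult_integrable[OF \<open>F \<in> L2\<close> \<open>G \<in> L2\<close>] by (simp add: mult.assoc)
  note lim = antiderivative_tendsto_at_top[OF D q int]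
  have limit: "(F x)\<^sup>2 + tail_integral ?q x = 0" for x
    by (rule integrable_nonneg_limit_eq_0[OF _ _ lim]) (use \<open>F \<in> L2\<close> in \<open>auto simp: L2_def\<close>)
  have "((\<lambda>x. (F x)\<^sup>2) \<longlongrightarrow> 0) at_top"
    using lim[of 0] limit by simp
  then have "((\<lambda>x. sqrt ((F x)\<^sup>2)) \<longlongrightarrow> sqrt 0) at_top"
    by (rule tendsto_real_sqrt)
  then show "(F \<longlongrightarrow> 0) at_top"
    by (simp add: tendsto_rabs_zero_iff)
  have "\<bar>F x\<bar> \<le> sqrt (LINT t|lebesgue. \<bar>?q t\<bar>)" for x
    using tail_integral_abs_le[OF int, of x] limit[of x]
    by (intro real_le_rsqrt) (simp only: power2_abs; linarith)
  then show "\<exists>B. \<forall>x. \<bar>F x\<bar> \<le> B"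
    by blast
qed

lemma C1_imp_H1:
  assumes F: "\<And>x. (F has_real_derivative G x) (at x)" and G: "continuous_on UNIV G"
    and "F \<in> L2" "G \<in> L2"
  shows "F \<in> H1"
  using assms has_weak_deriv_1I[OF F G] by (auto simp: H1_def)

lemma has_weak_deriv_AE_cong:
  assumes "has_weak_deriv k f g" and eq: "AE x in lebesgue. f x = F x" and F: "locally_integrable F"
  shows "has_weak_deriv k F g"
  unfolding has_weak_deriv_def
proof (intro conjI allI impI)
  show "locally_integrable F" "locally_integrable g"
    using assms by (auto simp: has_weak_deriv_def)
  fix \<eta> assume \<eta>: "test_function \<eta>"
  then have "test_function ((deriv ^^ k) \<eta>)"
    by (induction k) (auto intro: test_function_deriv)
  then have "(LINT x|lebesgue. f x * (deriv ^^ k) \<eta> x) = (LINT x|lebesgue. F x * (deriv ^^ k) \<eta> x)"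
    using eq assms(1) F integrable_times_test
    by (intro integral_cong_AE) (auto simp: has_weak_deriv_def elim: eventually_mono)
  then show "(LINT x|lebesgue. F x * (deriv ^^ k) \<eta> x) = (- 1) ^ k * (LINT x|lebesgue. g x * \<eta> x)"
    using assms(1) \<eta> by (simp add: has_weak_deriv_def)
qed

text \<open>The weak derivative \<open>g\<close> of \<open>f\<close> has the weak derivative \<open>h\<close>, hence a continuous representative \<open>G\<close>,
  and then \<open>f\<close> has a representative with derivative \<open>G\<close>. The continuity of \<open>h\<close> can only come last:
  in the applications \<open>h\<close> is expressed through \<open>f\<close> itself, so it has a continuous representative
  only once \<open>f\<close> has one.\<close>

lemma H1_weak_deriv_2_imp_C1:
  assumes f: "f \<in> H1" and h: "has_weak_deriv 2 f h"
  obtains F G where "\<And>x. (F has_real_derivative G x) (at x)" "continuous_on UNIV G"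
    "F \<in> L2" "G \<in> L2" "AE x in lebesgue. f x = F x" "has_weak_deriv 1 G h"
proof -
  obtain g where g: "g \<in> L2" "has_weak_deriv 1 f g" and "f \<in> L2"
    using f by (auto simp: H1_def)
  have gh: "has_weak_deriv 1 g h"
    by (rule has_weak_deriv_2D[OF g(2) h])
  obtain G where G: "continuous_on UNIV G" "AE x in lebesgue. g x = G x"
    using weak_deriv_imp_AE_continuous[OF gh] by blast
  obtain F where F: "\<And>x. (F has_real_derivative G x) (at x)" "AE x in lebesgue. f x = F x"
    using weak_deriv_continuous_imp_C1[OF g(2) G] by blast
  have F_cont: "continuous_on UNIV F"
    by (rule continuous_on_if_deriv[OF F(1)])
  show thesis
  proof (rule that[OF F(1) G(1) _ _ F(2)])
    show "F \<in> L2"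
      by (rule L2_AE_cong[OF F(2) \<open>f \<in> L2\<close> continuous_measurable_lebesgue[OF F_cont]])
    show "G \<in> L2"
      by (rule L2_AE_cong[OF G(2) g(1) continuous_measurable_lebesgue[OF G(1)]])
    show "has_weak_deriv 1 G h"
      by (rule has_weak_deriv_AE_cong[OF gh G(2) locally_integrable_continuous[OF G(1)]])
  qed
qed

lemma weak_deriv_of_continuous:
  assumes G: "has_weak_deriv 1 G h" "continuous_on UNIV G"
    and q: "continuous_on UNIV q" and eq: "AE x in lebesgue. h x = q x"
  shows "(G has_real_derivative q x) (at x)"
proof -
  obtain G' where G': "\<And>x. (G' has_real_derivative q x) (at x)" "AE x in lebesgue. G x = G' x"
    using weak_deriv_continuous_imp_C1[OF G(1) q eq] by blast
  have "continuous_on UNIV G'"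
    by (rule continuous_on_if_deriv[OF G'(1)])
  then have "G = G'"
    by (rule AE_eq_continuous_imp_eq[OF G'(2) G(2)])
  with G'(1) show ?thesis
    by simp
qed

section \<open>Monotonicity and energy arguments on the line\<close>

lemma nonneg_deriv_tendsto_0_imp_nonpos:
  fixes f :: "real \<Rightarrow> real"
  assumes deriv: "\<And>x. x \<ge> X \<Longrightarrow> (f has_real_derivative f' x) (at x)"
    and nonneg: "\<And>x. x \<ge> X \<Longrightarrow> f' x \<ge> 0"
    and lim: "(f \<longlongrightarrow> 0) at_top" and "x \<ge> X"
  shows "f x \<le> 0"
proof (rule tendsto_lowerbound[OF lim])
  show "eventually (\<lambda>y. f x \<le> f y) at_top"
    using eventually_ge_at_top[of x]
  proof eventually_elim
    case (elim y)
    show ?case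
      by (rule DERIV_nonneg_imp_nondecreasing[OF elim]) (meson deriv nonneg \<open>x \<ge> X\<close> order_trans)
  qed
qed simp

lemma zero_deriv_tendsto_0_imp_zero:
  fixes f :: "real \<Rightarrow> real"
  assumes deriv: "\<And>x. (f has_real_derivative 0) (at x)" and lim: "(f \<longlongrightarrow> 0) at_top"
  shows "f x = 0"
proof -
  have eq: "f y = f x" for y
    using DERIV_isconst_all[of f y x] deriv by blast
  have "((\<lambda>y :: real. f x) \<longlongrightarrow> 0) at_top"
    using lim by (rule Lim_transform_eventually) (intro always_eventually allI eq)
  then show ?thesis
    by (simp add: tendsto_const_iff)
qed

text \<open>Gronwall's argument in both directions: \<open>E x * exp (- L * x)\<close> is nonincreasing and
  \<open>E x * exp (L * x)\<close> is nondecreasing.\<close>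

lemma gronwall_zero:
  fixes E :: "real \<Rightarrow> real"
  assumes deriv: "\<And>x. (E has_real_derivative E' x) (at x)"
    and bound: "\<And>x. \<bar>E' x\<bar> \<le> L * E x" and nonneg: "\<And>x. 0 \<le> E x" and zero: "E x0 = 0"
  shows "E x = 0"
proof (cases "x0 \<le> x")
  case True
  have "E x * exp (- L * x) \<le> E x0 * exp (- L * x0)"
  proof (rule DERIV_nonpos_imp_nonincreasing[OF True])
    fix y
    have "((\<lambda>x. E x * exp (- L * x)) has_real_derivative (E' y - L * E y) * exp (- L * y)) (at y)"
      by (auto intro!: derivative_eq_intros deriv simp: algebra_simps)
    moreover have "(E' y - L * E y) * exp (- L * y) \<le> 0"
      using bound[of y] by (intro mult_nonpos_nonneg) auto
    ultimately show "\<exists>z. ((\<lambda>x. E x * exp (- L * x)) has_real_derivative z) (at y) \<and> z \<le> 0"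
      by blast
  qed
  then show ?thesis
    using zero nonneg[of x] by (simp add: mult_le_0_iff)
next
  case False
  then have "x \<le> x0"
    by simp
  then have "E x * exp (L * x) \<le> E x0 * exp (L * x0)"
  proof (rule DERIV_nonneg_imp_nondecreasing)
    fix y
    have "((\<lambda>x. E x * exp (L * x)) has_real_derivative (E' y + L * E y) * exp (L * y)) (at y)"
      by (auto intro!: derivative_eq_intros deriv simp: algebra_simps)
    moreover have "(E' y + L * E y) * exp (L * y) \<ge> 0"
      using bound[of y] by (intro mult_nonneg_nonneg) auto
    ultimately show "\<exists>z. ((\<lambda>x. E x * exp (L * x)) has_real_derivative z) (at y) \<and> z \<ge> 0"
      by blast
  qed
  then show ?thesis
    using zero nonneg[of x] by (simp add: mult_le_0_iff)
qed

section \<open>Standing waves and their linearization\<close>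

text \<open>Classical solutions, with an arbitrary finite number of components. The derivative \<open>v\<close> of \<open>u\<close> is a
  parameter, which turns the second-order system into a first-order one.\<close>

locale standing_wave =
  fixes \<kappa> :: "real ^ 'n" and u v :: "real \<Rightarrow> real ^ 'n"
  assumes \<kappa>_pos: "\<kappa> $ l > 0"
    and u_deriv: "((\<lambda>x. u x $ l) has_real_derivative v x $ l) (at x)"
    and v_deriv: "((\<lambda>x. v x $ l) has_real_derivative
      \<kappa> $ l * u x $ l - 2 * (\<Sum>j\<in>UNIV. (u x $ j)\<^sup>2) * u x $ l) (at x)"
    and u_L2: "(\<lambda>x. u x $ l) \<in> L2" and v_L2: "(\<lambda>x. v x $ l) \<in> L2"
begin

definition intensity :: "real \<Rightarrow> real" where
  "intensity x = (\<Sum>j\<in>UNIV. (u x $ j)\<^sup>2)"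

lemma v_deriv':
  "((\<lambda>x. v x $ l) has_real_derivative \<kappa> $ l * u x $ l - 2 * intensity x * u x $ l) (at x)"
  using v_deriv by (simp add: intensity_def)

lemma u_continuous: "continuous_on UNIV (\<lambda>x. u x $ l)"
  by (rule continuous_on_if_deriv[OF u_deriv])

lemma v_continuous: "continuous_on UNIV (\<lambda>x. v x $ l)"
  by (rule continuous_on_if_deriv[OF v_deriv])

lemma intensity_continuous: "continuous_on UNIV intensity"
  unfolding intensity_def by (intro continuous_intros u_continuous)

lemma intensity_nonneg: "0 \<le> intensity x"
  by (simp add: intensity_def sum_nonneg)

lemma u_tendsto_0: "((\<lambda>x. u x $ l) \<longlongrightarrow> 0) at_top"
  and u_bounded: "\<exists>B. \<forall>x. \<bar>u x $ l\<bar> \<le> B"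
  using L2_deriv_L2_decay[OF u_deriv v_continuous u_L2 v_L2] by blast+

lemma intensity_tendsto_0: "(intensity \<longlongrightarrow> 0) at_top"
proof -
  have "((\<lambda>x. \<Sum>j\<in>UNIV. (u x $ j)\<^sup>2) \<longlongrightarrow> (\<Sum>j\<in>(UNIV :: 'n set). 0\<^sup>2)) at_top"
    by (intro tendsto_intros u_tendsto_0)
  then show ?thesis
    by (simp add: intensity_def[abs_def])
qed

lemma u_uniformly_bounded: obtains B where "B \<ge> 0" "\<And>x l. \<bar>u x $ l\<bar> \<le> B"
proof -
  obtain b where b: "\<And>l x. \<bar>u x $ l\<bar> \<le> b l"
    using u_bounded by metis
  have "b l \<le> Max (range b)" for l
    by simp
  then have "\<bar>u x $ l\<bar> \<le> Max (range b)" for x l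
    using b order_trans by blast
  moreover from this have "0 \<le> Max (range b)"
    using abs_ge_zero order_trans by blast
  ultimately show thesis
    using that by blast
qed

lemma intensity_bounded: obtains B where "\<And>x. intensity x \<le> B"
proof -
  obtain B where B: "B \<ge> 0" "\<And>x l. \<bar>u x $ l\<bar> \<le> B"
    using u_uniformly_bounded by blast
  have "intensity x \<le> (\<Sum>j\<in>(UNIV :: 'n set). B\<^sup>2)" for x
    unfolding intensity_def using B by (intro sum_mono) (metis abs_le_square_iff abs_of_nonneg)
  then show thesis
    by (rule that)
qed

text \<open>The tails of the entries of the Gram matrix of the components; these are the functions \<open>S\<^sub>l\<^sub>j\<close> of the
  explicit solution formula.\<close>

definition overlap :: "'n \<Rightarrow> 'n \<Rightarrow> real \<Rightarrow> real" where
  "overlap l j = tail_integral (\<lambda>t. u t $ l * u t $ j)"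

lemma overlap_commute: "overlap l j = overlap j l"
  by (simp add: overlap_def mult.commute)

lemma overlap_deriv: "(overlap l j has_real_derivative - (u x $ l * u x $ j)) (at x)"
  and overlap_tendsto_0: "(overlap l j \<longlongrightarrow> 0) at_top"
  unfolding overlap_def
  by (intro tail_integral_has_deriv continuous_on_mult u_continuous L2_mult_integrable u_L2)+

lemma overlap_continuous: "continuous_on UNIV (overlap l j)"
  by (rule continuous_on_if_deriv[OF overlap_deriv])

lemma overlap_bounded: "\<exists>B. \<forall>x. \<bar>overlap l j x\<bar> \<le> B"
  unfolding overlap_def using tail_integral_abs_le[OF L2_mult_integrable[OF u_L2 u_L2]] by blast

text \<open>The function \<open>\<psi>\<close> is the derivative of \<open>\<phi>\<close>. Square integrability of both is the condition that \<open>\<phi>\<close>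
  lies in \<open>H\<^sup>1\<close>.\<close>

definition linearized :: "(real \<Rightarrow> real ^ 'n) \<Rightarrow> (real \<Rightarrow> real ^ 'n) \<Rightarrow> bool" where
  "linearized \<phi> \<psi> \<longleftrightarrow> (\<forall>l.
     (\<forall>x. ((\<lambda>x. \<phi> x $ l) has_real_derivative \<psi> x $ l) (at x) \<and>
       ((\<lambda>x. \<psi> x $ l) has_real_derivative \<kappa> $ l * \<phi> x $ l - 2 * intensity x * \<phi> x $ l
          - 4 * (\<Sum>j\<in>UNIV. u x $ j * \<phi> x $ j) * u x $ l) (at x)) \<and>
     (\<lambda>x. \<phi> x $ l) \<in> L2 \<and> (\<lambda>x. \<psi> x $ l) \<in> L2)"

lemma linearizedD:
  assumes "linearized \<phi> \<psi>"
  shows "((\<lambda>x. \<phi> x $ l) has_real_derivative \<psi> x $ l) (at x)"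
    and "((\<lambda>x. \<psi> x $ l) has_real_derivative \<kappa> $ l * \<phi> x $ l - 2 * intensity x * \<phi> x $ l
          - 4 * (\<Sum>j\<in>UNIV. u x $ j * \<phi> x $ j) * u x $ l) (at x)"
    and "(\<lambda>x. \<phi> x $ l) \<in> L2" and "(\<lambda>x. \<psi> x $ l) \<in> L2"
  using assms by (auto simp: linearized_def)

lemma linearized_continuous:
  assumes "linearized \<phi> \<psi>"
  shows "continuous_on UNIV (\<lambda>x. \<phi> x $ l)" and "continuous_on UNIV (\<lambda>x. \<psi> x $ l)"
  by (rule continuous_on_if_deriv, rule linearizedD[OF assms])+

lemma linearized_diff:
  assumes "linearized \<phi> \<psi>" "linearized \<phi>' \<psi>'"
  shows "linearized (\<lambda>x. \<phi> x - \<phi>' x) (\<lambda>x. \<psi> x - \<psi>' x)"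
  unfolding linearized_def
proof (intro allI conjI)
  note D = linearizedD[OF assms(1)] linearizedD[OF assms(2)]
  fix l
  show "(\<lambda>x. (\<phi> x - \<phi>' x) $ l) \<in> L2" "(\<lambda>x. (\<psi> x - \<psi>' x) $ l) \<in> L2"
    using D by (auto intro: L2_diff)
  fix x
  show "((\<lambda>x. (\<phi> x - \<phi>' x) $ l) has_real_derivative (\<psi> x - \<psi>' x) $ l) (at x)"
    using D by (auto intro: DERIV_diff)
  show "((\<lambda>x. (\<psi> x - \<psi>' x) $ l) has_real_derivative
      \<kappa> $ l * (\<phi> x - \<phi>' x) $ l - 2 * intensity x * (\<phi> x - \<phi>' x) $ l
      - 4 * (\<Sum>j\<in>UNIV. u x $ j * (\<phi> x - \<phi>' x) $ j) * u x $ l) (at x)"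
    using DERIV_diff[OF D(2)[of l x] D(6)[of l x]] 
    by (simp add: algebra_simps sum_subtractf)
qed

lemma L2_potential:
  assumes \<phi>: "\<And>l. (\<lambda>x. \<phi> x $ l) \<in> L2"
  shows "(\<lambda>x. \<kappa> $ l * \<phi> x $ l - 2 * intensity x * \<phi> x $ l
    - 4 * (\<Sum>j\<in>UNIV. u x $ j * \<phi> x $ j) * u x $ l) \<in> L2"
proof -
  obtain B where B: "B \<ge> 0" "\<And>x l. \<bar>u x $ l\<bar> \<le> B"
    using u_uniformly_bounded by blast
  obtain D where D: "\<And>x. intensity x \<le> D"
    using intensity_bounded by blast
  have 1: "(\<lambda>x. intensity x * \<phi> x $ l) \<in> L2"
    by (rule L2_bounded_mult[OF \<phi> intensity_continuous, of D]) (use D intensity_nonneg in simp)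
  have "(\<lambda>x. (u x $ j * u x $ l) * \<phi> x $ j) \<in> L2" for j
  proof (rule L2_bounded_mult[OF \<phi>, of _ "B * B"])
    show "\<bar>u x $ j * u x $ l\<bar> \<le> B * B" for x
      unfolding abs_mult by (intro mult_mono B) auto
  qed (intro continuous_intros u_continuous)
  then have "(\<lambda>x. \<Sum>j\<in>UNIV. (u x $ j * u x $ l) * \<phi> x $ j) \<in> L2"
    by (rule L2_sum)
  then have "(\<lambda>x. \<kappa> $ l * \<phi> x $ l - 2 * (intensity x * \<phi> x $ l)
      - 4 * (\<Sum>j\<in>UNIV. (u x $ j * u x $ l) * \<phi> x $ j)) \<in> L2"
    by (intro L2_diff L2_cmult \<phi> 1)
  then show ?thesis
    by (simp add: sum_distrib_left sum_distrib_right mult_ac)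
qed

lemma linearized_tendsto_0:
  assumes "linearized \<phi> \<psi>"
  shows "((\<lambda>x. \<phi> x $ l) \<longlongrightarrow> 0) at_top" and "((\<lambda>x. \<psi> x $ l) \<longlongrightarrow> 0) at_top"
proof -
  note D = linearizedD[OF assms] and C = linearized_continuous[OF assms]
  show "((\<lambda>x. \<phi> x $ l) \<longlongrightarrow> 0) at_top"
    by (rule L2_deriv_L2_decay(1)[OF D(1) C(2) D(3) D(4)])
  show "((\<lambda>x. \<psi> x $ l) \<longlongrightarrow> 0) at_top"
    by (rule L2_deriv_L2_decay(1)[OF D(2) _ D(4) L2_potential[OF D(3)]])
      (intro continuous_intros C intensity_continuous u_continuous)
qed

lemma v_tendsto_0: "((\<lambda>x. v x $ l) \<longlongrightarrow> 0) at_top"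
proof -
  obtain D where D: "\<And>x. intensity x \<le> D"
    using intensity_bounded by blast
  have "(\<lambda>x. intensity x * u x $ l) \<in> L2"
    by (rule L2_bounded_mult[OF u_L2 intensity_continuous, of D]) (use D intensity_nonneg in simp)
  then have "(\<lambda>x. \<kappa> $ l * u x $ l - 2 * (intensity x * u x $ l)) \<in> L2"
    by (intro L2_diff L2_cmult u_L2)
  then have "(\<lambda>x. \<kappa> $ l * u x $ l - 2 * intensity x * u x $ l) \<in> L2"
    by (simp add: mult.assoc)
  then show ?thesis
    by (intro L2_deriv_L2_decay(1)[OF v_deriv' _ v_L2])
      (intro continuous_intros u_continuous intensity_continuous)
qed

text \<open>The potential is a symmetric matrix, so the form has derivative zero; it tends to zero at infinity.
  In other words, the decaying solutions span an isotropic subspace.\<close>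

lemma linearized_symplectic_zero:
  assumes "linearized \<phi> \<psi>" "linearized \<phi>' \<psi>'"
  shows "(\<Sum>l\<in>UNIV. \<phi> x $ l * \<psi>' x $ l - \<psi> x $ l * \<phi>' x $ l) = 0"
proof -
  note D = linearizedD[OF assms(1)] and D' = linearizedD[OF assms(2)]
  let ?w = "\<lambda>x. \<Sum>l\<in>UNIV. \<phi> x $ l * \<psi>' x $ l - \<psi> x $ l * \<phi>' x $ l"
  have "(?w has_real_derivative 0) (at x)" for x
  proof -
    let ?r = "\<lambda>\<phi> l. \<kappa> $ l * \<phi> x $ l - 2 * intensity x * \<phi> x $ l
      - 4 * (\<Sum>j\<in>UNIV. u x $ j * \<phi> x $ j) * u x $ l"
    have "(?w has_real_derivative (\<Sum>l\<in>UNIV. (\<psi> x $ l * \<psi>' x $ l + ?r \<phi>' l * \<phi> x $ l)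
        - (?r \<phi> l * \<phi>' x $ l + \<psi>' x $ l * \<psi> x $ l))) (at x)"
      by (intro DERIV_sum DERIV_diff DERIV_mult D D')
    also have "(\<Sum>l\<in>UNIV. (\<psi> x $ l * \<psi>' x $ l + ?r \<phi>' l * \<phi> x $ l)
        - (?r \<phi> l * \<phi>' x $ l + \<psi>' x $ l * \<psi> x $ l)) =
        (\<Sum>l\<in>UNIV. 4 * (\<Sum>j\<in>UNIV. u x $ j * \<phi> x $ j) * (u x $ l * \<phi>' x $ l)
          - 4 * (\<Sum>j\<in>UNIV. u x $ j * \<phi>' x $ j) * (u x $ l * \<phi> x $ l))"
      by (rule sum.cong) (auto simp: algebra_simps)
    also have "\<dots> = 0"
      by (simp add: sum_subtractf sum_distrib_left[symmetric])
    finally show ?thesis .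
  qed
  moreover have "(?w \<longlongrightarrow> (\<Sum>l\<in>(UNIV :: 'n set). 0 * 0 - 0 * 0)) at_top"
    by (intro tendsto_intros linearized_tendsto_0[OF assms(1)] linearized_tendsto_0[OF assms(2)])
  ultimately show ?thesis
    by (intro zero_deriv_tendsto_0_imp_zero[of ?w]) simp_all
qed


section \<open>The explicit solutions of the linearized system\<close>

text \<open>Both sides tend to \<open>0\<close> at infinity and have the derivative \<open>(\<kappa>\<^sub>j - \<kappa>\<^sub>l) u\<^sub>l u\<^sub>j\<close>. This is the only
  place where the equation for \<open>u\<close> links the overlaps to \<open>\<kappa>\<close>.\<close>

lemma wronskian_eq_overlap:
  "u x $ l * v x $ j - v x $ l * u x $ j = (\<kappa> $ l - \<kappa> $ j) * overlap l j x"
proof -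
  let ?w = "\<lambda>x. (u x $ l * v x $ j - v x $ l * u x $ j) - (\<kappa> $ l - \<kappa> $ j) * overlap l j x"
  have "(?w has_real_derivative 0) (at x)" for x
    by (auto intro!: derivative_eq_intros u_deriv v_deriv' overlap_deriv simp: algebra_simps)
  moreover have "(?w \<longlongrightarrow> (0 * 0 - 0 * 0) - (\<kappa> $ l - \<kappa> $ j) * 0) at_top"
    by (intro tendsto_intros u_tendsto_0 v_tendsto_0 overlap_tendsto_0)
  ultimately have "?w x = 0"
    by (intro zero_deriv_tendsto_0_imp_zero[of ?w]) simp_all
  then show ?thesis
    by simp
qed

text \<open>The explicit solutions \<open>\<phi>\<^sup>c\<close>. If all \<open>c\<^sub>l\<close> are equal, the sum disappears and \<open>variation c\<close> is a
  multiple of the derivative of \<open>u\<close>; the sum corrects \<open>c\<^sub>l u\<^sub>l'\<close> if the components are shifted at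
  different speeds \<open>c\<^sub>l\<close>.\<close>

definition variation :: "real ^ 'n \<Rightarrow> real \<Rightarrow> real ^ 'n" where
  "variation c x = (\<chi> l. c $ l * v x $ l - (\<Sum>j\<in>UNIV. (c $ l - c $ j) * (overlap l j x * u x $ j)))"

text \<open>The derivative of \<open>variation c\<close>, with second derivatives of \<open>u\<close> eliminated by the equation.\<close>

definition variation_deriv :: "real ^ 'n \<Rightarrow> real \<Rightarrow> real ^ 'n" where
  "variation_deriv c x = (\<chi> l. c $ l * \<kappa> $ l * u x $ l - c $ l * intensity x * u x $ l
     - (\<Sum>j\<in>UNIV. c $ j * (u x $ j)\<^sup>2) * u x $ l
     - (\<Sum>j\<in>UNIV. (c $ l - c $ j) * (overlap l j x * v x $ j)))"

lemma linear_variation: "linear (\<lambda>c. variation c x)"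
  by (rule linearI)
    (auto simp: variation_def vec_eq_iff algebra_simps sum.distrib sum_subtractf sum_distrib_left)

text \<open>The factor \<open>(c\<^sub>l - c\<^sub>j) S\<^sub>l\<^sub>j\<close> is antisymmetric in \<open>l\<close> and \<open>j\<close>, so the overlap terms cancel.\<close>

lemma inner_variation:
  "(\<Sum>l\<in>UNIV. u x $ l * variation c x $ l) = (\<Sum>l\<in>UNIV. c $ l * (u x $ l * v x $ l))"
proof -
  let ?T = "\<lambda>l j. (c $ l - c $ j) * (overlap l j x * (u x $ l * u x $ j))"
  have "(\<Sum>l\<in>UNIV. \<Sum>j\<in>UNIV. ?T l j) = (\<Sum>j\<in>UNIV. \<Sum>l\<in>UNIV. ?T l j)"
    by (rule sum.swap)
  also have "\<dots> = (\<Sum>j\<in>UNIV. \<Sum>l\<in>UNIV. - ?T j l)"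
  proof (intro sum.cong refl)
    fix l j show "?T l j = - ?T j l"
      by (simp add: overlap_commute[of l j] algebra_simps)
  qed
  finally have "(\<Sum>l\<in>UNIV. \<Sum>j\<in>UNIV. ?T l j) = 0"
    by (simp add: sum_negf)
  moreover have "(\<Sum>l\<in>UNIV. u x $ l * variation c x $ l) =
      (\<Sum>l\<in>UNIV. c $ l * (u x $ l * v x $ l)) - (\<Sum>l\<in>UNIV. \<Sum>j\<in>UNIV. ?T l j)"
    by (simp add: variation_def right_diff_distrib sum_subtractf sum_distrib_left mult_ac)
  ultimately show ?thesis
    by simp
qed

lemma variation_has_deriv:
  "((\<lambda>x. variation c x $ l) has_real_derivative variation_deriv c x $ l) (at x)"
proof -
  let ?N = "intensity x"
  have "((\<lambda>x. variation c x $ l) has_real_derivative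
      c $ l * (\<kappa> $ l * u x $ l - 2 * ?N * u x $ l)
      - (\<Sum>j\<in>UNIV. (c $ l - c $ j) * (- (u x $ l * u x $ j) * u x $ j + v x $ j * overlap l j x))) (at x)"
    unfolding variation_def vec_lambda_beta
    by (intro DERIV_diff DERIV_cmult DERIV_sum DERIV_mult v_deriv' u_deriv overlap_deriv)
  also have "(\<Sum>j\<in>UNIV. (c $ l - c $ j) * (- (u x $ l * u x $ j) * u x $ j + v x $ j * overlap l j x)) =
      (\<Sum>j\<in>UNIV. (c $ l - c $ j) * (overlap l j x * v x $ j)
        - c $ l * u x $ l * (u x $ j)\<^sup>2 + u x $ l * (c $ j * (u x $ j)\<^sup>2))"
    by (rule sum.cong) (auto simp: algebra_simps power2_eq_square)
  also have "\<dots> = (\<Sum>j\<in>UNIV. (c $ l - c $ j) * (overlap l j x * v x $ j))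
      - c $ l * u x $ l * ?N + u x $ l * (\<Sum>j\<in>UNIV. c $ j * (u x $ j)\<^sup>2)"
    by (simp add: sum.distrib sum_subtractf sum_distrib_left intensity_def)
  finally show ?thesis
    by (rule DERIV_cong) (simp add: variation_deriv_def algebra_simps)
qed

lemma intensity_deriv:
  "(intensity has_real_derivative 2 * (\<Sum>j\<in>UNIV. u x $ j * v x $ j)) (at x)"
proof -
  have "((\<lambda>x. \<Sum>j\<in>UNIV. u x $ j ^ 2) has_real_derivative (\<Sum>j\<in>UNIV. 2 * (u x $ j * v x $ j))) (at x)"
    by (intro DERIV_sum) (auto intro!: derivative_eq_intros u_deriv)
  then show ?thesis
    by (simp add: intensity_def[abs_def] sum_distrib_left)
qed

lemma weighted_intensity_deriv:
  "((\<lambda>x. \<Sum>j\<in>UNIV. c $ j * (u x $ j)\<^sup>2) has_real_derivative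
    2 * (\<Sum>j\<in>UNIV. c $ j * (u x $ j * v x $ j))) (at x)"
proof -
  have "((\<lambda>x. \<Sum>j\<in>UNIV. c $ j * (u x $ j)\<^sup>2) has_real_derivative
      (\<Sum>j\<in>UNIV. 2 * (c $ j * (u x $ j * v x $ j)))) (at x)"
    by (intro DERIV_sum) (auto intro!: derivative_eq_intros u_deriv)
  then show ?thesis
    by (simp add: sum_distrib_left)
qed

text \<open>The core computation. Differentiating the last sum of \<open>variation_deriv\<close> produces \<open>\<kappa>\<^sub>j S\<^sub>l\<^sub>j\<close>
  where \<open>\<kappa>\<^sub>l S\<^sub>l\<^sub>j\<close> is wanted. The Wronskian relation exchanges them at the price of cubic terms in \<open>u\<close>
  and \<open>v\<close>, and these complete the remaining cubic terms to
  \<open>- 2 \<bar>u\<bar>\<^sup>2 \<phi>\<^sub>l - 4 (\<Sum>j. u\<^sub>j \<phi>\<^sub>j) u\<^sub>l\<close>.\<close>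

lemma variation_deriv_has_deriv:
  "((\<lambda>x. variation_deriv c x $ l) has_real_derivative
     \<kappa> $ l * variation c x $ l - 2 * intensity x * variation c x $ l
     - 4 * (\<Sum>j\<in>UNIV. u x $ j * variation c x $ j) * u x $ l) (at x)"
proof -
  let ?N = "intensity x" and ?P = "\<Sum>j\<in>UNIV. u x $ j * v x $ j"
  let ?Q = "\<Sum>j\<in>UNIV. c $ j * (u x $ j)\<^sup>2" and ?R = "\<Sum>j\<in>UNIV. c $ j * (u x $ j * v x $ j)"
  let ?A = "\<Sum>j\<in>UNIV. (c $ l - c $ j) * (overlap l j x * u x $ j)"
  have deriv: "((\<lambda>x. variation_deriv c x $ l) has_real_derivative
      c $ l * \<kappa> $ l * v x $ l
      - c $ l * (2 * ?P * u x $ l + v x $ l * ?N)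
      - (2 * ?R * u x $ l + v x $ l * ?Q)
      - (\<Sum>j\<in>UNIV. (c $ l - c $ j) * (- (u x $ l * u x $ j) * v x $ j
          + (\<kappa> $ j * u x $ j - 2 * ?N * u x $ j) * overlap l j x))) (at x)"
    unfolding variation_deriv_def vec_lambda_beta mult.assoc[of "c $ l" "intensity _"]
    by (intro DERIV_diff DERIV_cmult DERIV_sum DERIV_mult v_deriv' u_deriv overlap_deriv
        intensity_deriv weighted_intensity_deriv)
  have "(\<Sum>j\<in>UNIV. (c $ l - c $ j) * (- (u x $ l * u x $ j) * v x $ j
          + (\<kappa> $ j * u x $ j - 2 * ?N * u x $ j) * overlap l j x)) =
      (\<Sum>j\<in>UNIV. (\<kappa> $ l - 2 * ?N) * ((c $ l - c $ j) * (overlap l j x * u x $ j))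
        - 2 * (c $ l * u x $ l) * (u x $ j * v x $ j) + 2 * u x $ l * (c $ j * (u x $ j * v x $ j))
        + c $ l * v x $ l * (u x $ j)\<^sup>2 - v x $ l * (c $ j * (u x $ j)\<^sup>2))"
  proof (rule sum.cong)
    fix j
    have eq: "\<kappa> $ j * overlap l j x = \<kappa> $ l * overlap l j x - (u x $ l * v x $ j - v x $ l * u x $ j)"
      using wronskian_eq_overlap[of x l j] by (simp add: algebra_simps)
    have *: "(\<kappa> $ j * u x $ j - 2 * ?N * u x $ j) * overlap l j x =
        (\<kappa> $ l * overlap l j x - (u x $ l * v x $ j - v x $ l * u x $ j)) * u x $ j
        - 2 * ?N * u x $ j * overlap l j x"
      unfolding eq[symmetric] by (simp add: algebra_simps)
    show "(c $ l - c $ j) * (- (u x $ l * u x $ j) * v x $ j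
          + (\<kappa> $ j * u x $ j - 2 * ?N * u x $ j) * overlap l j x) =
        (\<kappa> $ l - 2 * ?N) * ((c $ l - c $ j) * (overlap l j x * u x $ j))
        - 2 * (c $ l * u x $ l) * (u x $ j * v x $ j) + 2 * u x $ l * (c $ j * (u x $ j * v x $ j))
        + c $ l * v x $ l * (u x $ j)\<^sup>2 - v x $ l * (c $ j * (u x $ j)\<^sup>2)"
      unfolding * by (simp add: algebra_simps power2_eq_square)
  qed simp
  also have "\<dots> = (\<kappa> $ l - 2 * ?N) * ?A - 2 * (c $ l * u x $ l) * ?P + 2 * u x $ l * ?R
      + c $ l * v x $ l * ?N - v x $ l * ?Q"
    by (simp only: sum.distrib sum_subtractf sum_distrib_left[symmetric] intensity_def)
  finally show ?thesis
    unfolding inner_variation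
    by (intro DERIV_cong[OF deriv]) (simp add: variation_def algebra_simps)
qed

lemma linearized_variation: "linearized (variation c) (variation_deriv c)"
proof -
  have overlap_mult: "(\<lambda>x. \<Sum>j\<in>UNIV. (c $ l - c $ j) * (overlap l j x * w x $ j)) \<in> L2"
    if "\<And>j. (\<lambda>x. w x $ j) \<in> L2" for l and w :: "real \<Rightarrow> real ^ 'n"
  proof (intro L2_sum L2_cmult)
    fix j
    obtain B where "\<And>x. \<bar>overlap l j x\<bar> \<le> B"
      using overlap_bounded by blast
    then show "(\<lambda>x. overlap l j x * w x $ j) \<in> L2"
      by (rule L2_bounded_mult[OF that overlap_continuous])
  qed
  obtain B where B: "B \<ge> 0" "\<And>x l. \<bar>u x $ l\<bar> \<le> B"
    using u_uniformly_bounded by blast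
  have cube: "(\<lambda>x. (u x $ j)\<^sup>2 * u x $ l) \<in> L2" for j l
  proof (rule L2_bounded_mult[OF u_L2, of _ "B\<^sup>2"])
    show "\<bar>(u x $ j)\<^sup>2\<bar> \<le> B\<^sup>2" for x
      using B by (metis abs_le_square_iff abs_of_nonneg power2_abs abs_power2)
  qed (intro continuous_intros u_continuous)
  have "(\<lambda>x. variation c x $ l) \<in> L2" for l
    unfolding variation_def vec_lambda_beta by (intro L2_diff L2_cmult v_L2 u_L2 overlap_mult)
  moreover have "(\<lambda>x. variation_deriv c x $ l) \<in> L2" for l
  proof -
    have "(\<lambda>x. c $ l * \<kappa> $ l * u x $ l - c $ l * (\<Sum>j\<in>UNIV. (u x $ j)\<^sup>2 * u x $ l)
        - (\<Sum>j\<in>UNIV. c $ j * ((u x $ j)\<^sup>2 * u x $ l))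
        - (\<Sum>j\<in>UNIV. (c $ l - c $ j) * (overlap l j x * v x $ j))) \<in> L2"
      by (intro L2_diff L2_cmult L2_sum cube u_L2 overlap_mult v_L2)
    then show ?thesis
      by (simp add: variation_deriv_def intensity_def sum_distrib_left sum_distrib_right mult.assoc)
  qed
  ultimately show ?thesis
    unfolding linearized_def using variation_has_deriv variation_deriv_has_deriv by blast
qed


section \<open>Uniqueness and asymptotics\<close>

text \<open>The energy \<open>\<bar>\<phi>\<bar>\<^sup>2 + \<bar>\<psi>\<bar>\<^sup>2\<close> satisfies a Gronwall inequality because the coefficients are bounded on the
  whole line.\<close>

lemma linearized_unique:
  assumes lin: "linearized \<phi> \<psi>" and zero: "\<phi> x0 = 0" "\<psi> x0 = 0"
  shows "\<phi> x = 0"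
proof -
  note D = linearizedD[OF lin]
  obtain B where B: "B \<ge> 0" "\<And>x l. \<bar>u x $ l\<bar> \<le> B"
    using u_uniformly_bounded by blast
  obtain N where N: "\<And>x. intensity x \<le> N"
    using intensity_bounded by blast
  have "N \<ge> 0"
    using N[of 0] intensity_nonneg[of 0] by linarith
  define K where "K = (\<Sum>l\<in>UNIV. \<kappa> $ l)"
  have K: "\<kappa> $ l \<le> K" "0 \<le> K" for l
    unfolding K_def by (auto intro!: member_le_sum sum_nonneg simp: \<kappa>_pos less_imp_le)
  let ?r = "\<lambda>x l. \<kappa> $ l * \<phi> x $ l - 2 * intensity x * \<phi> x $ l
    - 4 * (\<Sum>j\<in>UNIV. u x $ j * \<phi> x $ j) * u x $ l"
  let ?E = "\<lambda>x. \<Sum>l\<in>UNIV. (\<phi> x $ l)\<^sup>2 + (\<psi> x $ l)\<^sup>2"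
  let ?E' = "\<lambda>x. \<Sum>l\<in>UNIV. 2 * \<phi> x $ l * \<psi> x $ l + 2 * \<psi> x $ l * ?r x l"
  define M where "M = K + 2 * N + 4 * B * B * real CARD('n)"
  have M: "M \<ge> 0"
    using K \<open>N \<ge> 0\<close> B by (simp add: M_def)
  define L where "L = real CARD('n) * (2 + 2 * M)"
  have comp: "\<bar>\<phi> x $ l\<bar> \<le> sqrt (?E x)" "\<bar>\<psi> x $ l\<bar> \<le> sqrt (?E x)" for x l
  proof -
    have "(\<phi> x $ l)\<^sup>2 + (\<psi> x $ l)\<^sup>2 \<le> ?E x"
      by (rule member_le_sum[of l UNIV "\<lambda>l. (\<phi> x $ l)\<^sup>2 + (\<psi> x $ l)\<^sup>2"]) auto
    then have "(\<phi> x $ l)\<^sup>2 \<le> ?E x" "(\<psi> x $ l)\<^sup>2 \<le> ?E x"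
      using zero_le_power2[of "\<phi> x $ l"] zero_le_power2[of "\<psi> x $ l"] by linarith+
    then show "\<bar>\<phi> x $ l\<bar> \<le> sqrt (?E x)" "\<bar>\<psi> x $ l\<bar> \<le> sqrt (?E x)"
      by (metis real_sqrt_abs real_sqrt_le_iff)+
  qed
  have bound: "\<bar>?E' x\<bar> \<le> L * ?E x" for x
  proof -
    define s where "s = sqrt (?E x)"
    have s: "\<bar>\<phi> x $ l\<bar> \<le> s" "\<bar>\<psi> x $ l\<bar> \<le> s" for l
      using comp unfolding s_def by blast+
    have "s \<ge> 0"
      using s(1) abs_ge_zero order_trans by blast
    have s2: "s * s = ?E x"
      unfolding s_def by (simp add: sum_nonneg)
    have "\<bar>?r x l\<bar> \<le> M * s" for l
    proof -
      have "\<bar>\<kappa> $ l * \<phi> x $ l\<bar> \<le> K * s"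
        unfolding abs_mult using K(1)[of l] K(2) s \<kappa>_pos[of l] by (intro mult_mono) auto
      moreover have "\<bar>intensity x * \<phi> x $ l\<bar> \<le> N * s"
        unfolding abs_mult using N[of x] intensity_nonneg[of x] s \<open>N \<ge> 0\<close> by (intro mult_mono) auto
      moreover have "\<bar>(\<Sum>j\<in>UNIV. u x $ j * \<phi> x $ j) * u x $ l\<bar> \<le> (real CARD('n) * (B * s)) * B"
      proof -
        have "\<bar>\<Sum>j\<in>UNIV. u x $ j * \<phi> x $ j\<bar> \<le> (\<Sum>j\<in>(UNIV :: 'n set). B * s)"
          by (rule order_trans[OF sum_abs sum_mono])
            (use B s in \<open>auto simp: abs_mult intro!: mult_mono\<close>)
        then show ?thesis
          unfolding abs_mult using B \<open>s \<ge> 0\<close> by (intro mult_mono) auto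
      qed
      ultimately show ?thesis
        unfolding M_def by (simp add: algebra_simps abs_le_iff)
    qed
    then have "\<bar>2 * \<phi> x $ l * \<psi> x $ l + 2 * \<psi> x $ l * ?r x l\<bar> \<le> (2 + 2 * M) * (s * s)" for l
    proof -
      have "\<bar>\<phi> x $ l * \<psi> x $ l\<bar> \<le> s * s"
        unfolding abs_mult using s \<open>s \<ge> 0\<close> by (intro mult_mono) auto
      moreover have "\<bar>\<psi> x $ l * ?r x l\<bar> \<le> s * (M * s)"
        unfolding abs_mult using s \<open>s \<ge> 0\<close> \<open>\<And>l. \<bar>?r x l\<bar> \<le> M * s\<close> by (intro mult_mono) auto
      ultimately show ?thesis
        by (simp add: algebra_simps abs_le_iff)
    qed
    then have "\<bar>?E' x\<bar> \<le> (\<Sum>l\<in>(UNIV :: 'n set). (2 + 2 * M) * (s * s))"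
      by (intro order_trans[OF sum_abs sum_mono])
    then show ?thesis
      unfolding s2[symmetric] by (simp add: L_def)
  qed
  have "?E x = 0"
  proof (rule gronwall_zero[OF _ bound])
    show "(?E has_real_derivative ?E' x) (at x)" for x
      by (intro DERIV_sum DERIV_add) (auto intro!: derivative_eq_intros D)
    show "?E x \<ge> 0" for x
      by (intro sum_nonneg) auto
    show "?E x0 = 0"
      by (simp add: zero)
  qed
  then have "(\<phi> x $ l)\<^sup>2 + (\<psi> x $ l)\<^sup>2 = 0" for l
    by (subst (asm) sum_nonneg_eq_0_iff) auto
  then show ?thesis
    by (simp add: vec_eq_iff)
qed

end

text \<open>The tail \<open>S\<close> of \<open>p\<close> is compared with \<open>p / (2 \<delta>)\<close>: the decay of \<open>p\<close> makes the difference monotone, and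
  everything tends to zero.\<close>

lemma tail_bound_positive:
  fixes p S :: "real \<Rightarrow> real"
  assumes S: "\<And>x. (S has_real_derivative - p x) (at x)" and p: "\<And>x. (p has_real_derivative p' x) (at x)"
    and pos: "\<And>x. x \<ge> X \<Longrightarrow> p x > 0" and decay: "\<And>x. x \<ge> X \<Longrightarrow> p' x \<le> - (2 * \<delta> * p x)"
    and "\<delta> > 0" and lim: "(S \<longlongrightarrow> 0) at_top" "(p \<longlongrightarrow> 0) at_top" and "x \<ge> X"
  shows "\<bar>S x\<bar> \<le> p x / (2 * \<delta>)"
proof -
  have "S x - p x / (2 * \<delta>) \<le> 0"
  proof (rule nonneg_deriv_tendsto_0_imp_nonpos[where X = X and f = "\<lambda>x. S x - p x / (2 * \<delta>)"])
    show "((\<lambda>x. S x - p x / (2 * \<delta>)) has_real_derivative - p y - p' y / (2 * \<delta>)) (at y)" for y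
      by (intro DERIV_diff DERIV_cdivide S p)
    show "- p y - p' y / (2 * \<delta>) \<ge> 0" if "y \<ge> X" for y
      using decay[OF that] \<open>\<delta> > 0\<close> by (simp add: field_simps)
    have "((\<lambda>x. S x - p x / (2 * \<delta>)) \<longlongrightarrow> 0 - 0 / (2 * \<delta>)) at_top"
      using \<open>\<delta> > 0\<close> by (intro tendsto_intros lim) auto
    then show "((\<lambda>x. S x - p x / (2 * \<delta>)) \<longlongrightarrow> 0) at_top"
      by simp
  qed (rule \<open>x \<ge> X\<close>)
  moreover have "- S x \<le> 0"
  proof (rule nonneg_deriv_tendsto_0_imp_nonpos[where X = X and f = "\<lambda>x. - S x"])
    show "((\<lambda>x. - S x) has_real_derivative p y) (at y)" for y
      using DERIV_minus[OF S] by simp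
    show "p y \<ge> 0" if "y \<ge> X" for y
      using pos[OF that] by simp
    show "((\<lambda>x. - S x) \<longlongrightarrow> 0) at_top"
      using tendsto_minus[OF lim(1)] by simp
  qed (rule \<open>x \<ge> X\<close>)
  ultimately show ?thesis
    by simp
qed

text \<open>A function without zeros has constant sign, so the estimate holds for \<open>p\<close> or for \<open>- p\<close>. The decay
  rate is stated in a form that does not depend on the sign.\<close>

lemma tail_bound_nonvanishing:
  fixes p S :: "real \<Rightarrow> real"
  assumes S: "\<And>x. (S has_real_derivative - p x) (at x)" and p: "\<And>x. (p has_real_derivative p' x) (at x)"
    and nonzero: "\<And>x. x \<ge> X \<Longrightarrow> p x \<noteq> 0"
    and decay: "\<And>x. x \<ge> X \<Longrightarrow> p x * p' x \<le> - (2 * \<delta> * (p x)\<^sup>2)"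
    and "\<delta> > 0" and lim: "(S \<longlongrightarrow> 0) at_top" "(p \<longlongrightarrow> 0) at_top" and "x \<ge> X"
  shows "\<bar>S x\<bar> \<le> \<bar>p x\<bar> / (2 * \<delta>)"
proof -
  have p_cont: "continuous_on A p" for A
    by (rule continuous_on_if_deriv[OF p])
  have "(\<forall>x\<ge>X. p x > 0) \<or> (\<forall>x\<ge>X. p x < 0)"
  proof (rule ccontr)
    assume "\<not> ?thesis"
    then obtain y z where "y \<ge> X" "z \<ge> X" "p y < 0" "p z > 0"
      using nonzero by (metis linorder_neqE_linordered_idom)
    then have "0 \<in> p ` {X..}"
      using connectedD_interval[OF connected_continuous_image[OF p_cont connected_Ici, of X], of "p y" "p z" 0]
      by auto
    then show False
      using nonzero by auto
  qed
  then show ?thesis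
  proof
    assume pos: "\<forall>x\<ge>X. p x > 0"
    have "\<bar>S x\<bar> \<le> p x / (2 * \<delta>)"
    proof (rule tail_bound_positive[OF S p _ _ \<open>\<delta> > 0\<close> lim \<open>x \<ge> X\<close>])
      fix y assume "y \<ge> X"
      then have "p y > 0"
        using pos by simp
      have "p y * p' y \<le> p y * (- (2 * \<delta> * p y))"
        using decay[OF \<open>y \<ge> X\<close>] by (simp add: power2_eq_square mult_ac)
      then show "p' y \<le> - (2 * \<delta> * p y)"
        using \<open>p y > 0\<close> by (simp only: mult_le_cancel_left_pos)
    qed (use pos in auto)
    moreover have "\<bar>p x\<bar> = p x"
      using pos \<open>x \<ge> X\<close> by force
    ultimately show ?thesis
      by simp
  next
    assume neg: "\<forall>x\<ge>X. p x < 0"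
    have "\<bar>- S x\<bar> \<le> - p x / (2 * \<delta>)"
    proof (rule tail_bound_positive[where S = "\<lambda>x. - S x" and p = "\<lambda>x. - p x" and p' = "\<lambda>x. - p' x" and X = X])
      show "((\<lambda>x. - S x) has_real_derivative - (- p y)) (at y)" for y
        by (rule DERIV_minus[OF S])
      show "((\<lambda>x. - p x) has_real_derivative - p' y) (at y)" for y
        by (rule DERIV_minus[OF p])
      fix y assume "y \<ge> X"
      then have "p y < 0"
        using neg by simp
      have "p y * p' y \<le> p y * (- (2 * \<delta> * p y))"
        using decay[OF \<open>y \<ge> X\<close>] by (simp add: power2_eq_square mult_ac)
      then have "- (2 * \<delta> * p y) \<le> p' y"
        using \<open>p y < 0\<close> by (simp only: mult_le_cancel_left_neg)
      then show "- p' y \<le> - (2 * \<delta> * - p y)"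
        by simp
    qed (use neg \<open>\<delta> > 0\<close> \<open>x \<ge> X\<close> tendsto_minus[OF lim(1)] tendsto_minus[OF lim(2)] in auto)
    moreover have "\<bar>p x\<bar> = - p x"
      using neg \<open>x \<ge> X\<close> by force
    ultimately show ?thesis
      by simp
  qed
qed

context standing_wave
begin

text \<open>The coefficient of the scalar equation for \<open>u\<^sub>l\<close> is bounded, so a component with vanishing Cauchy data
  vanishes identically.\<close>

lemma component_unique:
  assumes zero: "u x0 $ l = 0" "v x0 $ l = 0"
  shows "u x $ l = 0"
proof -
  obtain N where N: "\<And>x. intensity x \<le> N"
    using intensity_bounded by blast
  let ?q = "\<lambda>x. \<kappa> $ l - 2 * intensity x"
  let ?M = "\<kappa> $ l + 2 * N"
  let ?E = "\<lambda>x. (u x $ l)\<^sup>2 + (v x $ l)\<^sup>2"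
  have "?E x = 0"
  proof (rule gronwall_zero[where E = ?E and L = "1 + ?M"])
    show "(?E has_real_derivative 2 * (u x $ l * v x $ l) * (1 + ?q x)) (at x)" for x
      by (auto intro!: derivative_eq_intros u_deriv v_deriv' simp: algebra_simps)
    show "\<bar>2 * (u x $ l * v x $ l) * (1 + ?q x)\<bar> \<le> (1 + ?M) * ?E x" for x
    proof -
      have "\<bar>1 + ?q x\<bar> \<le> 1 + ?M"
        using N[of x] intensity_nonneg[of x] \<kappa>_pos[of l] by (simp add: abs_le_iff)
      moreover have "\<bar>2 * (u x $ l * v x $ l)\<bar> \<le> ?E x"
        using sum_squares_bound[of "\<bar>u x $ l\<bar>" "\<bar>v x $ l\<bar>"] by (simp add: abs_mult mult.assoc)
      ultimately have "\<bar>2 * (u x $ l * v x $ l)\<bar> * \<bar>1 + ?q x\<bar> \<le> ?E x * (1 + ?M)"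
        by (intro mult_mono) auto
      then show ?thesis
        by (simp add: abs_mult mult.commute)
    qed
    show "?E x \<ge> 0" for x
      by simp
    show "?E x0 = 0"
      by (simp add: zero)
  qed
  then show ?thesis
    by (simp add: sum_power2_eq_zero_iff)
qed

text \<open>Where the coefficient \<open>q = \<kappa>\<^sub>l - 2 \<bar>u\<bar>\<^sup>2\<close> is at least \<open>\<delta>\<^sup>2\<close>, the product \<open>u\<^sub>l v\<^sub>l\<close> has the nonnegative
  derivative \<open>v\<^sub>l\<^sup>2 + q u\<^sub>l\<^sup>2\<close> and tends to \<open>0\<close>, so it is nonpositive. Then
  \<open>\<delta>\<^sup>2 u\<^sub>l\<^sup>2 - v\<^sub>l\<^sup>2\<close> has the nonnegative derivative \<open>2 (\<delta>\<^sup>2 - q) u\<^sub>l v\<^sub>l\<close> and is nonpositive by the same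
  argument. Together: \<open>\<bar>v\<^sub>l\<bar> \<ge> \<delta> \<bar>u\<^sub>l\<bar>\<close>, with \<open>v\<^sub>l\<close> of the sign opposite to \<open>u\<^sub>l\<close>.\<close>

lemma exponential_decay:
  assumes "\<delta> > 0" and q: "\<And>x. x \<ge> X \<Longrightarrow> \<delta>\<^sup>2 \<le> \<kappa> $ l - 2 * intensity x" and "x \<ge> X"
  shows "u x $ l * v x $ l \<le> - (\<delta> * (u x $ l)\<^sup>2)"
proof -
  let ?q = "\<lambda>x. \<kappa> $ l - 2 * intensity x"
  have sign: "u y $ l * v y $ l \<le> 0" if "y \<ge> X" for y
  proof (rule nonneg_deriv_tendsto_0_imp_nonpos[where X = X and f = "\<lambda>x. u x $ l * v x $ l"])
    show "((\<lambda>x. u x $ l * v x $ l) has_real_derivative (v y $ l)\<^sup>2 + ?q y * (u y $ l)\<^sup>2) (at y)" for y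
      by (auto intro!: derivative_eq_intros u_deriv v_deriv' simp: algebra_simps power2_eq_square)
    show "(v y $ l)\<^sup>2 + ?q y * (u y $ l)\<^sup>2 \<ge> 0" if "y \<ge> X" for y
    proof -
      have "?q y \<ge> 0"
        using q[OF that] zero_le_power2[of \<delta>] by linarith
      then show ?thesis
        by simp
    qed
    show "((\<lambda>x. u x $ l * v x $ l) \<longlongrightarrow> 0) at_top"
      using tendsto_mult[OF u_tendsto_0 v_tendsto_0] by simp
  qed (rule that)
  have "\<delta>\<^sup>2 * (u x $ l)\<^sup>2 - (v x $ l)\<^sup>2 \<le> 0"
  proof (rule nonneg_deriv_tendsto_0_imp_nonpos[where X = X
        and f = "\<lambda>x. \<delta>\<^sup>2 * (u x $ l)\<^sup>2 - (v x $ l)\<^sup>2"])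
    show "((\<lambda>x. \<delta>\<^sup>2 * (u x $ l)\<^sup>2 - (v x $ l)\<^sup>2) has_real_derivative
        2 * ((\<delta>\<^sup>2 - ?q y) * (u y $ l * v y $ l))) (at y)" for y
      by (auto intro!: derivative_eq_intros u_deriv v_deriv' simp: algebra_simps power2_eq_square)
    show "2 * ((\<delta>\<^sup>2 - ?q y) * (u y $ l * v y $ l)) \<ge> 0" if "y \<ge> X" for y
      using q[OF that] sign[OF that] mult_nonpos_nonpos[of "\<delta>\<^sup>2 - ?q y" "u y $ l * v y $ l"] by simp
    have "((\<lambda>x. \<delta>\<^sup>2 * (u x $ l)\<^sup>2 - (v x $ l)\<^sup>2) \<longlongrightarrow> \<delta>\<^sup>2 * 0\<^sup>2 - 0\<^sup>2) at_top"
      by (intro tendsto_intros u_tendsto_0 v_tendsto_0)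
    then show "((\<lambda>x. \<delta>\<^sup>2 * (u x $ l)\<^sup>2 - (v x $ l)\<^sup>2) \<longlongrightarrow> 0) at_top"
      by simp
  qed (rule \<open>x \<ge> X\<close>)
  then have "(\<delta> * u x $ l)\<^sup>2 \<le> (v x $ l)\<^sup>2"
    by (simp add: power_mult_distrib)
  then have "\<delta> * \<bar>u x $ l\<bar> \<le> \<bar>v x $ l\<bar>"
    using \<open>\<delta> > 0\<close> by (simp add: abs_le_square_iff[symmetric] abs_mult)
  then have "\<bar>u x $ l\<bar> * (\<delta> * \<bar>u x $ l\<bar>) \<le> \<bar>u x $ l\<bar> * \<bar>v x $ l\<bar>"
    by (rule mult_left_mono) simp
  then have "\<delta> * (u x $ l)\<^sup>2 \<le> \<bar>u x $ l * v x $ l\<bar>"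
    by (simp add: abs_mult power2_eq_square mult_ac)
  with sign[OF \<open>x \<ge> X\<close>] show ?thesis
    by linarith
qed

text \<open>Since \<open>u\<^sub>l\<^sup>2\<close> is nonincreasing beyond \<open>X\<close>, a zero there would make \<open>u\<^sub>l\<close> vanish on a half-line and hence
  everywhere.\<close>

lemma eventually_nonzero:
  assumes "\<delta> > 0" and q: "\<And>x. x \<ge> X \<Longrightarrow> \<delta>\<^sup>2 \<le> \<kappa> $ l - 2 * intensity x"
    and nontrivial: "u y $ l \<noteq> 0" and "x \<ge> X"
  shows "u x $ l \<noteq> 0"
proof
  assume zero: "u x $ l = 0"
  have decreasing: "(u z $ l)\<^sup>2 \<le> (u x $ l)\<^sup>2" if "z \<ge> x" for z
  proof (rule DERIV_nonpos_imp_nonincreasing[OF that])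
    fix w assume "x \<le> w"
    with \<open>x \<ge> X\<close> have "w \<ge> X"
      by simp
    have "u w $ l * v w $ l \<le> - (\<delta> * (u w $ l)\<^sup>2)"
      by (rule exponential_decay[OF assms(1) q \<open>w \<ge> X\<close>])
    moreover have "0 \<le> \<delta> * (u w $ l)\<^sup>2"
      using \<open>\<delta> > 0\<close> by simp
    moreover have "((\<lambda>x. (u x $ l)\<^sup>2) has_real_derivative 2 * (u w $ l * v w $ l)) (at w)"
      by (auto intro!: derivative_eq_intros u_deriv)
    ultimately show "\<exists>d. ((\<lambda>x. (u x $ l)\<^sup>2) has_real_derivative d) (at w) \<and> d \<le> 0"
      by force
  qed
  then have vanish: "u z $ l = 0" if "z \<ge> x" for z
    using that zero by fastforce
  have "((\<lambda>z. u z $ l) has_real_derivative 0) (at (x + 1))"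
  proof (subst DERIV_cong_ev[OF refl _ refl])
    show "eventually (\<lambda>z. u z $ l = 0) (nhds (x + 1))"
      using eventually_nhds_in_open[of "{x<..}" "x + 1"] by (auto elim!: eventually_mono intro: vanish)
  qed simp
  then have "v (x + 1) $ l = 0"
    using u_deriv DERIV_unique by blast
  moreover have "u (x + 1) $ l = 0"
    by (rule vanish) simp
  ultimately have "u y $ l = 0"
    by (rule component_unique[rotated])
  with nontrivial show False ..
qed

text \<open>Suppose \<open>variation c\<close> vanishes at a point \<open>X\<close> beyond which the asymptotic estimates hold. For the
  index \<open>l\<close> with the largest \<open>\<bar>c\<^sub>l\<bar>\<close>, the bounds on \<open>v\<^sub>l\<close> and on the overlaps give
  \<open>\<delta> \<bar>c\<^sub>l u\<^sub>l\<bar> \<le> \<bar>c\<^sub>l u\<^sub>l\<bar> \<bar>u\<bar>\<^sup>2 / \<delta>\<close>, which forces \<open>c\<^sub>l = 0\<close> once \<open>\<bar>u\<bar>\<^sup>2 < \<delta>\<^sup>2\<close>.\<close>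

lemma exists_variation_injective:
  assumes nontrivial: "\<And>l. \<exists>x. u x $ l \<noteq> 0"
  obtains x0 where "inj (\<lambda>c. variation c x0)"
proof -
  define m where "m = Min (range (\<lambda>l. \<kappa> $ l))"
  have m: "m > 0" "m \<le> \<kappa> $ l" for l
    using \<kappa>_pos by (auto simp: m_def)
  (* taking half of the minimum leaves room for the term 2 |u|^2 in the coefficient *)
  define \<delta> where "\<delta> = sqrt (m / 2)"
  have \<delta>: "\<delta> > 0" "\<delta>\<^sup>2 = m / 2"
    using m by (auto simp: \<delta>_def)
  have "eventually (\<lambda>x. intensity x < m / 4) at_top"
    by (rule order_tendstoD(2)[OF intensity_tendsto_0]) (use m in simp)
  then obtain X where X: "\<And>x. x \<ge> X \<Longrightarrow> intensity x < m / 4"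
    by (auto simp: eventually_at_top_linorder)
  have q: "\<delta>\<^sup>2 \<le> \<kappa> $ l - 2 * intensity x" if "x \<ge> X" for l x
    using X[OF that] m(2)[of l] \<delta>(2) by simp
  have u_nonzero: "u x $ l \<noteq> 0" if "x \<ge> X" for l x
    using eventually_nonzero[OF \<delta>(1) q _ that] nontrivial by blast
  note decay = exponential_decay[OF \<delta>(1) q]
  have overlap: "\<bar>overlap l j X\<bar> \<le> \<bar>u X $ l * u X $ j\<bar> / (2 * \<delta>)" for l j
  proof (rule tail_bound_nonvanishing[where S = "overlap l j" and p = "\<lambda>x. u x $ l * u x $ j"])
    show "(overlap l j has_real_derivative - (u x $ l * u x $ j)) (at x)" for x
      by (rule overlap_deriv)
    show "((\<lambda>x. u x $ l * u x $ j) has_real_derivative v x $ l * u x $ j + v x $ j * u x $ l) (at x)" for x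
      by (rule DERIV_mult[OF u_deriv u_deriv])
    show "u x $ l * u x $ j \<noteq> 0" if "x \<ge> X" for x
      using u_nonzero[OF that] by simp
    show "(u x $ l * u x $ j) * (v x $ l * u x $ j + v x $ j * u x $ l) \<le>
        - (2 * \<delta> * (u x $ l * u x $ j)\<^sup>2)" if "x \<ge> X" for x
    proof -
      have "(u x $ l * v x $ l) * (u x $ j)\<^sup>2 \<le> - (\<delta> * (u x $ l)\<^sup>2) * (u x $ j)\<^sup>2"
        by (rule mult_right_mono[OF decay]) (use that in auto)
      moreover have "(u x $ j * v x $ j) * (u x $ l)\<^sup>2 \<le> - (\<delta> * (u x $ j)\<^sup>2) * (u x $ l)\<^sup>2"
        by (rule mult_right_mono[OF decay]) (use that in auto)
      ultimately show ?thesis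
        by (simp add: algebra_simps power2_eq_square)
    qed
    show "((\<lambda>x. u x $ l * u x $ j) \<longlongrightarrow> 0) at_top"
      using tendsto_mult[OF u_tendsto_0 u_tendsto_0] by simp
  qed (use \<delta> overlap_tendsto_0 in auto)
  have "c = 0" if zero: "variation c X = 0" for c
  proof -
    have "Max (range (\<lambda>l. \<bar>c $ l\<bar>)) \<in> range (\<lambda>l. \<bar>c $ l\<bar>)"
      by (rule Max_in) auto
    then obtain l where "Max (range (\<lambda>l. \<bar>c $ l\<bar>)) = \<bar>c $ l\<bar>"
      by (rule rangeE)
    then have l: "\<bar>c $ j\<bar> \<le> \<bar>c $ l\<bar>" for j
      by (metis Max_ge finite_imageI finite rangeI)
    let ?a = "\<bar>u X $ l\<bar>"
    have a: "?a > 0"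
      using u_nonzero[of X l] by simp
    have "\<delta> * ?a * ?a \<le> \<bar>v X $ l\<bar> * ?a"
      using decay[of X X l] by (simp add: abs_mult[symmetric] power2_eq_square mult_ac)
    then have v: "\<delta> * ?a \<le> \<bar>v X $ l\<bar>"
      using a by (simp only: mult_le_cancel_right_pos)
    have "c $ l * v X $ l = (\<Sum>j\<in>UNIV. (c $ l - c $ j) * (overlap l j X * u X $ j))"
      using zero by (simp add: variation_def vec_eq_iff)
    then have "\<bar>c $ l\<bar> * \<bar>v X $ l\<bar> \<le> (\<Sum>j\<in>UNIV. \<bar>(c $ l - c $ j) * (overlap l j X * u X $ j)\<bar>)"
      by (metis abs_mult sum_abs)
    also have "\<dots> \<le> (\<Sum>j\<in>UNIV. (2 * \<bar>c $ l\<bar>) * ((?a * \<bar>u X $ j\<bar> / (2 * \<delta>)) * \<bar>u X $ j\<bar>))"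
      unfolding abs_mult
    proof (intro sum_mono mult_mono)
      show "\<bar>c $ l - c $ j\<bar> \<le> 2 * \<bar>c $ l\<bar>" for j
        using l[of j] by linarith
      show "\<bar>overlap l j X\<bar> \<le> ?a * \<bar>u X $ j\<bar> / (2 * \<delta>)" for j
        using overlap[of l j] by (simp add: abs_mult)
    qed (use \<delta> in auto)
    also have "\<dots> = (\<Sum>j\<in>UNIV. (\<bar>c $ l\<bar> * ?a / \<delta>) * (u X $ j)\<^sup>2)"
    proof (intro sum.cong refl)
      fix j
      have "2 * \<bar>c $ l\<bar> * ((?a * b / (2 * \<delta>)) * b) = (\<bar>c $ l\<bar> * ?a / \<delta>) * (b * b)" for b
        by simp
      then show "2 * \<bar>c $ l\<bar> * ((?a * \<bar>u X $ j\<bar> / (2 * \<delta>)) * \<bar>u X $ j\<bar>) =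
          (\<bar>c $ l\<bar> * ?a / \<delta>) * (u X $ j)\<^sup>2"
        by (simp only: abs_mult_self_eq power2_eq_square)
    qed
    also have "\<dots> = (\<bar>c $ l\<bar> * ?a / \<delta>) * intensity X"
      unfolding intensity_def by (rule sum_distrib_left[symmetric])
    finally have "\<bar>c $ l\<bar> * \<bar>v X $ l\<bar> \<le> (\<bar>c $ l\<bar> * ?a / \<delta>) * intensity X" .
    moreover have "\<bar>c $ l\<bar> * (\<delta> * ?a) \<le> \<bar>c $ l\<bar> * \<bar>v X $ l\<bar>"
      using v by (rule mult_left_mono) simp
    ultimately have "\<bar>c $ l\<bar> * (\<delta> * ?a) \<le> (\<bar>c $ l\<bar> * ?a * intensity X) / \<delta>"
      by simp
    then have "\<bar>c $ l\<bar> * (\<delta> * ?a) * \<delta> \<le> \<bar>c $ l\<bar> * ?a * intensity X"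
      using \<delta>(1) by (simp only: pos_le_divide_eq)
    also have "\<bar>c $ l\<bar> * (\<delta> * ?a) * \<delta> = \<bar>c $ l\<bar> * ?a * (m / 2)"
      unfolding \<delta>(2)[symmetric] by (simp only: power2_eq_square mult_ac)
    finally have le: "\<bar>c $ l\<bar> * ?a * (m / 2) \<le> \<bar>c $ l\<bar> * ?a * intensity X" .
    have "intensity X < m / 2"
      using X[of X] m(1) by linarith
    with le have "\<bar>c $ l\<bar> * ?a \<le> 0"
      using mult_strict_left_mono[of "intensity X" "m / 2" "\<bar>c $ l\<bar> * ?a"] by linarith
    then have "c $ l = 0"
      using a by (simp add: mult_le_0_iff)
    then have "c $ j = 0" for j
      using l[of j] by simp
    then show "c = 0"
      by (simp add: vec_eq_iff)
  qed
  then have "inj (\<lambda>c. variation c X)"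
    by (simp add: linear_injective_0[OF linear_variation])
  then show thesis
    by (rule that)
qed

text \<open>Evaluation of the variations at \<open>x0\<close> is onto, so \<open>\<phi>\<close> agrees at \<open>x0\<close> with some \<open>variation c\<close>. The
  symplectic form of the difference \<open>\<theta>\<close> with all variations vanishes, and at \<open>x0\<close> it pairs \<open>\<theta>'\<close> with
  arbitrary vectors.\<close>

lemma linearized_imp_variation:
  assumes inj: "inj (\<lambda>c. variation c x0)" and lin: "linearized \<phi> \<psi>"
  obtains c where "\<phi> = variation c"
proof -
  have surj: "surj (\<lambda>c. variation c x0)"
    by (rule linear_inj_imp_surj[OF linear_variation inj])
  then obtain c where c: "\<phi> x0 = variation c x0"
    by (metis surjD)
  let ?\<theta> = "\<lambda>x. \<phi> x - variation c x" and ?\<theta>' = "\<lambda>x. \<psi> x - variation_deriv c x"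
  have \<theta>: "linearized ?\<theta> ?\<theta>'"
    by (rule linearized_diff[OF lin linearized_variation])
  have \<theta>0: "?\<theta> x0 = 0"
    using c by simp
  (* pairing with this variation produces the squared norm of the derivative *)
  obtain d where d: "?\<theta>' x0 = variation d x0"
    using surj by (metis surjD)
  have "(\<Sum>l\<in>UNIV. ?\<theta> x0 $ l * variation_deriv d x0 $ l - ?\<theta>' x0 $ l * variation d x0 $ l) = 0"
    by (rule linearized_symplectic_zero[OF \<theta> linearized_variation])
  then have "(\<Sum>l\<in>UNIV. (?\<theta>' x0 $ l)\<^sup>2) = 0"
    unfolding \<theta>0 d[symmetric] by (simp add: sum_negf power2_eq_square)
  then have "?\<theta>' x0 = 0"
    by (simp add: sum_nonneg_eq_0_iff vec_eq_iff)
  then have "?\<theta> x = 0" for x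
    by (rule linearized_unique[OF \<theta> \<theta>0])
  then show thesis
    by (intro that[of c]) (simp add: fun_eq_iff)
qed

end

section \<open>The space of weak solutions\<close>

lemma AE_vec_eq_if:
  fixes f g :: "real \<Rightarrow> real ^ 'n"
  assumes "\<And>i. AE x in lebesgue. f x $ i = g x $ i"
  shows "AE x in lebesgue. f x = g x"
proof -
  have "AE x in lebesgue. \<forall>i\<in>UNIV. f x $ i = g x $ i"
    using assms by (subst AE_finite_all) auto
  then show ?thesis
    by (simp add: vec_eq_iff)
qed

text \<open>The regularity lemma for all components at once. The predicate \<open>Q\<close> carries the equation satisfied by
  the weak second derivatives through the choice of representatives.\<close>

lemma H1_weak_deriv_2_imp_C1_vec:
  fixes f :: "real \<Rightarrow> real ^ 'n"
  assumes H1: "\<And>i. (\<lambda>x. f x $ i) \<in> H1"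
    and weak: "\<And>i. \<exists>h. has_weak_deriv 2 (\<lambda>x. f x $ i) h \<and> Q i h"
  obtains F G :: "real \<Rightarrow> real ^ 'n" and h
  where "\<And>i x. ((\<lambda>x. F x $ i) has_real_derivative G x $ i) (at x)"
    and "\<And>i. continuous_on UNIV (\<lambda>x. G x $ i)"
    and "\<And>i. (\<lambda>x. F x $ i) \<in> L2" and "\<And>i. (\<lambda>x. G x $ i) \<in> L2"
    and "AE x in lebesgue. f x = F x"
    and "\<And>i. has_weak_deriv 1 (\<lambda>x. G x $ i) (h i)" and "\<And>i. Q i (h i)"
proof -
  have "\<forall>i. \<exists>h F G. (\<forall>x. (F has_real_derivative G x) (at x)) \<and> continuous_on UNIV G \<and>
      F \<in> L2 \<and> G \<in> L2 \<and> (AE x in lebesgue. f x $ i = F x) \<and> has_weak_deriv 1 G h \<and> Q i h"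
    (is "\<forall>i. \<exists>h F G. ?P i h F G")
  proof
    fix i
    obtain h where h: "has_weak_deriv 2 (\<lambda>x. f x $ i) h" "Q i h"
      using weak by blast
    obtain F G where "\<And>x. (F has_real_derivative G x) (at x)" "continuous_on UNIV G"
      "F \<in> L2" "G \<in> L2" "AE x in lebesgue. f x $ i = F x" "has_weak_deriv 1 G h"
      using H1_weak_deriv_2_imp_C1[OF H1 h(1)] by blast
    with h(2) show "\<exists>h F G. ?P i h F G"
      by blast
  qed
  then obtain h F G where FG: "\<And>i. ?P i (h i) (F i) (G i)"
    unfolding choice_iff by blast
  have "AE x in lebesgue. f x = (\<chi> i. F i x)"
    by (rule AE_vec_eq_if) (simp add: FG)
  then show thesis
    by (intro that[of "\<lambda>x. \<chi> i. F i x" "\<lambda>x. \<chi> i. G i x" h]) (simp_all add: FG del: One_nat_def)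
qed

text \<open>Once \<open>u\<close> is replaced by a continuous representative, the second derivatives prescribed by the
  equation are continuous too, hence classical.\<close>

lemma solution_regular:
  fixes \<mu> :: "real ^ 3"
  assumes sol: "is_solution \<mu> u" and neg: "\<And>i. \<mu> $ i < 0"
  obtains U V where "standing_wave (- \<mu>) U V" "AE x in lebesgue. u x = U x"
proof -
  obtain U V h where U: "\<And>i x. ((\<lambda>x. U x $ i) has_real_derivative V x $ i) (at x)"
    and V: "\<And>i. continuous_on UNIV (\<lambda>x. V x $ i)"
    and L2: "\<And>i. (\<lambda>x. U x $ i) \<in> L2" "\<And>i. (\<lambda>x. V x $ i) \<in> L2"
    and uU: "AE x in lebesgue. u x = U x"
    and h: "\<And>i. has_weak_deriv 1 (\<lambda>x. V x $ i) (h i)"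
    and eq: "\<And>i. AE x in lebesgue. h i x + 2 * ((u x $ 1)\<^sup>2 + (u x $ 2)\<^sup>2 + (u x $ 3)\<^sup>2) * u x $ i
      = - (\<mu> $ i) * u x $ i"
    by (rule H1_weak_deriv_2_imp_C1_vec[of u "\<lambda>i h. AE x in lebesgue.
          h x + 2 * ((u x $ 1)\<^sup>2 + (u x $ 2)\<^sup>2 + (u x $ 3)\<^sup>2) * u x $ i = - (\<mu> $ i) * u x $ i"])
      (use sol in \<open>auto simp: is_solution_def\<close>)
  have "((\<lambda>x. V x $ i) has_real_derivative
      (- \<mu>) $ i * U x $ i - 2 * (\<Sum>j\<in>UNIV. (U x $ j)\<^sup>2) * U x $ i) (at x)" for i x
  proof (rule weak_deriv_of_continuous[OF h V])
    show "continuous_on UNIV (\<lambda>x. (- \<mu>) $ i * U x $ i - 2 * (\<Sum>j\<in>UNIV. (U x $ j)\<^sup>2) * U x $ i)"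
      by (intro continuous_intros continuous_on_if_deriv[OF U])
    show "AE x in lebesgue. h i x = (- \<mu>) $ i * U x $ i - 2 * (\<Sum>j\<in>UNIV. (U x $ j)\<^sup>2) * U x $ i"
      using eq[of i] uU by eventually_elim (simp add: sum_3 algebra_simps)
  qed
  then have "standing_wave (- \<mu>) U V"
    using U L2 neg by unfold_locales auto
  then show thesis
    using uU by (rule that)
qed

context standing_wave
begin

lemma linear_ae_class_variation: "linear (\<lambda>c. ae_class (variation c))"
proof (rule linearI)
  fix c d :: "real ^ 'n" and r :: real
  show "ae_class (variation (c + d)) = ae_class (variation c) + ae_class (variation d)"
    unfolding plus_ae_fun.abs_eq using linear_add[OF linear_variation]
    by (intro arg_cong[where f = ae_class] ext)
  show "ae_class (variation (r *\<^sub>R c)) = r *\<^sub>R ae_class (variation c)"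
    unfolding scaleR_ae_fun.abs_eq using linear_scale[OF linear_variation]
    by (intro arg_cong[where f = ae_class] ext)
qed

lemma inj_ae_class_variation:
  assumes inj: "inj (\<lambda>c. variation c x0)"
  shows "inj (\<lambda>c. ae_class (variation c))"
proof (rule injI)
  fix c d assume "ae_class (variation c) = ae_class (variation d)"
  then have ae: "AE x in lebesgue. variation c x = variation d x"
    by (simp add: ae_fun.abs_eq_iff)
  have "(\<lambda>x. variation c x $ l) = (\<lambda>x. variation d x $ l)" for l
    by (rule AE_eq_continuous_imp_eq[OF _ linearized_continuous(1)[OF linearized_variation]
          linearized_continuous(1)[OF linearized_variation]])
      (use ae in \<open>auto elim: eventually_mono\<close>)
  then have "variation c x0 = variation d x0"
    by (simp add: vec_eq_iff fun_eq_iff)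
  then show "c = d"
    by (rule injD[OF inj])
qed

end

context
  fixes \<mu> :: "real ^ 3" and u U V :: "real \<Rightarrow> real ^ 3"
  assumes wave: "standing_wave (- \<mu>) U V" and uU: "AE x in lebesgue. u x = U x"
begin

interpretation standing_wave "- \<mu>" U V
  by (rule wave)

lemma linearized_solution_regular:
  assumes sol: "is_linearized_solution \<mu> u \<phi>"
  obtains \<Phi> \<Psi> where "linearized \<Phi> \<Psi>" "AE x in lebesgue. \<phi> x = \<Phi> x"
proof -
  obtain \<Phi> \<Psi> h where \<Phi>: "\<And>i x. ((\<lambda>x. \<Phi> x $ i) has_real_derivative \<Psi> x $ i) (at x)"
    and \<Psi>: "\<And>i. continuous_on UNIV (\<lambda>x. \<Psi> x $ i)"
    and L2: "\<And>i. (\<lambda>x. \<Phi> x $ i) \<in> L2" "\<And>i. (\<lambda>x. \<Psi> x $ i) \<in> L2"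
    and \<phi>\<Phi>: "AE x in lebesgue. \<phi> x = \<Phi> x"
    and h: "\<And>i. has_weak_deriv 1 (\<lambda>x. \<Psi> x $ i) (h i)"
    and eq: "\<And>i. AE x in lebesgue. h i x + 2 * ((u x $ 1)\<^sup>2 + (u x $ 2)\<^sup>2 + (u x $ 3)\<^sup>2) * \<phi> x $ i
        + 4 * (u x $ 1 * \<phi> x $ 1 + u x $ 2 * \<phi> x $ 2 + u x $ 3 * \<phi> x $ 3) * u x $ i
      = - (\<mu> $ i) * \<phi> x $ i"
    by (rule H1_weak_deriv_2_imp_C1_vec[of \<phi> "\<lambda>i h. AE x in lebesgue.
          h x + 2 * ((u x $ 1)\<^sup>2 + (u x $ 2)\<^sup>2 + (u x $ 3)\<^sup>2) * \<phi> x $ i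
            + 4 * (u x $ 1 * \<phi> x $ 1 + u x $ 2 * \<phi> x $ 2 + u x $ 3 * \<phi> x $ 3) * u x $ i
          = - (\<mu> $ i) * \<phi> x $ i"])
      (use sol in \<open>auto simp: is_linearized_solution_def\<close>)
  have "((\<lambda>x. \<Psi> x $ i) has_real_derivative (- \<mu>) $ i * \<Phi> x $ i - 2 * intensity x * \<Phi> x $ i
      - 4 * (\<Sum>j\<in>UNIV. U x $ j * \<Phi> x $ j) * U x $ i) (at x)" for i x
  proof (rule weak_deriv_of_continuous[OF h \<Psi>])
    show "continuous_on UNIV (\<lambda>x. (- \<mu>) $ i * \<Phi> x $ i - 2 * intensity x * \<Phi> x $ i
        - 4 * (\<Sum>j\<in>UNIV. U x $ j * \<Phi> x $ j) * U x $ i)"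
      by (intro continuous_intros continuous_on_if_deriv[OF \<Phi>] intensity_continuous u_continuous)
    show "AE x in lebesgue. h i x = (- \<mu>) $ i * \<Phi> x $ i - 2 * intensity x * \<Phi> x $ i
        - 4 * (\<Sum>j\<in>UNIV. U x $ j * \<Phi> x $ j) * U x $ i"
      using eq[of i] uU \<phi>\<Phi> by eventually_elim (simp add: intensity_def sum_3 algebra_simps)
  qed
  then have "linearized \<Phi> \<Psi>"
    unfolding linearized_def using \<Phi> L2 by blast
  then show thesis
    using \<phi>\<Phi> by (rule that)
qed

lemma linearized_imp_linearized_solution:
  assumes lin: "linearized \<Phi> \<Psi>"
  shows "is_linearized_solution \<mu> u \<Phi>"
  unfolding is_linearized_solution_def
proof (intro conjI allI)
  fix i
  note D = linearizedD[OF lin] and C = linearized_continuous[OF lin]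
  let ?h = "\<lambda>x. (- \<mu>) $ i * \<Phi> x $ i - 2 * intensity x * \<Phi> x $ i
    - 4 * (\<Sum>j\<in>UNIV. U x $ j * \<Phi> x $ j) * U x $ i"
  show "(\<lambda>x. \<Phi> x $ i) \<in> H1"
    by (rule C1_imp_H1[OF D(1) C(2) D(3) D(4)])
  have "has_weak_deriv 2 (\<lambda>x. \<Phi> x $ i) ?h"
    by (rule has_weak_deriv_2I[OF D(1) D(2)])
      (intro continuous_intros C intensity_continuous u_continuous)
  moreover have "AE x in lebesgue. ?h x + 2 * ((u x $ 1)\<^sup>2 + (u x $ 2)\<^sup>2 + (u x $ 3)\<^sup>2) * \<Phi> x $ i
       + 4 * (u x $ 1 * \<Phi> x $ 1 + u x $ 2 * \<Phi> x $ 2 + u x $ 3 * \<Phi> x $ 3) * u x $ i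
     = - (\<mu> $ i) * \<Phi> x $ i"
    using uU by eventually_elim (simp add: intensity_def sum_3 algebra_simps)
  ultimately show "\<exists>\<phi>''. has_weak_deriv 2 (\<lambda>x. \<Phi> x $ i) \<phi>'' \<and>
      (AE x in lebesgue. \<phi>'' x + 2 * ((u x $ 1)\<^sup>2 + (u x $ 2)\<^sup>2 + (u x $ 3)\<^sup>2) * \<Phi> x $ i
       + 4 * (u x $ 1 * \<Phi> x $ 1 + u x $ 2 * \<Phi> x $ 2 + u x $ 3 * \<Phi> x $ 3) * u x $ i
     = - (\<mu> $ i) * \<Phi> x $ i)"
    by blast
qed

text \<open>The solution space is defined by weak equations with coefficients \<open>u\<close>; almost everywhere they are the
  classical equations with coefficients \<open>U\<close>, and the classical \<open>H\<^sup>1\<close> solutions are the variations.\<close>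

lemma linearized_solution_space_eq:
  assumes inj: "inj (\<lambda>c. variation c x0)"
  shows "linearized_solution_space \<mu> u = range (\<lambda>c. ae_class (variation c))"
proof (intro set_eqI iffI)
  fix \<xi> assume "\<xi> \<in> linearized_solution_space \<mu> u"
  then obtain \<phi> where \<phi>: "is_linearized_solution \<mu> u \<phi>" "\<xi> = ae_class \<phi>"
    by (auto simp: linearized_solution_space_def)
  obtain \<Phi> \<Psi> where \<Phi>: "linearized \<Phi> \<Psi>" "AE x in lebesgue. \<phi> x = \<Phi> x"
    using linearized_solution_regular[OF \<phi>(1)] .
  obtain c where "\<Phi> = variation c"
    using linearized_imp_variation[OF inj \<Phi>(1)] .
  with \<phi>(2) \<Phi>(2) show "\<xi> \<in> range (\<lambda>c. ae_class (variation c))"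
    by (auto simp: ae_fun.abs_eq_iff)
next
  fix \<xi> assume "\<xi> \<in> range (\<lambda>c. ae_class (variation c))"
  then show "\<xi> \<in> linearized_solution_space \<mu> u"
    using linearized_imp_linearized_solution[OF linearized_variation]
    by (auto simp: linearized_solution_space_def)
qed

end

lemma dim_range_linear_inj:
  fixes T :: "'a :: euclidean_space \<Rightarrow> 'b :: real_vector"
  assumes "linear T" "inj T"
  shows "subspace (range T)" "dim (range T) = DIM('a)"
proof -
  have span: "span (T ` Basis) = range T"
    by (simp add: linear_span_image[OF assms(1)])
  then show "subspace (range T)"
    using subspace_span[of "T ` Basis"] by simp
  have "independent (T ` Basis)"
    using assms independent_Basis by (intro linear_independent_injective_image) auto
  then have "dim (T ` Basis) = card (T ` Basis)"
    by (rule dim_eq_card_independent)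
  also have "\<dots> = DIM('a)"
    using assms(2) by (intro card_image) (auto intro: inj_on_subset)
  finally show "dim (range T) = DIM('a)"
    by (metis span dim_span)
qed

theorem theorem1p4:
  fixes \<mu> :: "real ^ 3" and u :: "real \<Rightarrow> real ^ 3"
  assumes "\<mu> $ 1 \<le> \<mu> $ 2" and "\<mu> $ 2 \<le> \<mu> $ 3" and "\<mu> $ 3 < 0"
    and "is_solution \<mu> u"
    and "\<And>i. \<not> (AE x in lebesgue. u x $ i = 0)"
  shows "subspace (linearized_solution_space \<mu> u) \<and>
    dim (linearized_solution_space \<mu> u) = 3"
proof -
  have "\<forall>i. \<mu> $ i < 0"
    unfolding forall_3 using assms(1-3) by auto
  then obtain U V where wave: "standing_wave (- \<mu>) U V" and uU: "AE x in lebesgue. u x = U x"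
    using solution_regular[OF assms(4)] by metis
  interpret standing_wave "- \<mu>" U V
    by (rule wave)
  have "\<exists>x. U x $ i \<noteq> 0" for i
  proof (rule ccontr)
    assume "\<nexists>x. U x $ i \<noteq> 0"
    then have "AE x in lebesgue. u x $ i = 0"
      using uU by (auto elim: eventually_mono)
    with assms(5) show False
      by blast
  qed
  then obtain x0 where inj: "inj (\<lambda>c. variation c x0)"
    by (rule exists_variation_injective)
  have "linearized_solution_space \<mu> u = range (\<lambda>c. ae_class (variation c))"
    by (rule linearized_solution_space_eq[OF wave uU inj])
  then show ?thesis
    using dim_range_linear_inj[OF linear_ae_class_variation inj_ae_class_variation[OF inj]]
    by simp
qed

end
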